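(* Let $S$ be a primitive substitution over a finite alphabet $\mathcal{A}$ with Perron–Frobenius eigenvalue $\theta_S$. There is a constant $C_1=C_1(S)>0$ such that for every initial configuration $\omega_0\in\mathcal{A}^{\mathbb{Z}}$ which is a good approximant, $$d_{\mathcal{H}}\big(\Omega_n(\omega_0),\Omega(S)\big)\le \frac{C_1}{\theta_S^n}\quad\text{for all }n\in\mathbb{N}.$$ If moreover $\Omega(S)$ is aperiodic (infinite) and $\omega_0$ is periodic, then there is a constant $C_2=C_2(\omega_0;S)>0$ such that $$\frac{C_2}{\theta_S^n}\le d_{\mathcal{H}}\big(\Omega_n(\omega_0),\Omega(S)\big)\quad\text{for all }n\in\mathbb{N}.$$
   Context: Configurations are maps $\omega:\mathbb{Z}\to\mathcal{A}$ with shift action $(m\cdot\omega)(n)=\omega(n-m)$ and metric $d(\omega_1,\omega_2)=\inf\{\frac1{r+1}: r\ge0,\ \omega_1|_{(-r,r)}=\omega_2|_{(-r,r)}\}$; a subshift is a nonempty closed shift-invariant set; $d_{\mathcal{H}}$ is the Hausdorff metric on subshifts induced by $d$. A substitution $S:\mathcal{A}\to\mathcal{A}^+$ is extended to words and configurations by concatenation (with $S(\omega(0))$ starting at position $0$); it is primitive if for some $p$, every letter occurs in $S^p(a)$ for all $a$. Its substitution matrix $M(S)$ has $(i,j)$ entry the number of occurrences of $a_i$ in $S(a_j)$; for primitive $S$, $\theta_S$ is its Perron–Frobenius eigenvalue. Legal words $W(S)$ are the subwords of the words $S^n(a)$, $a\in\mathcal{A}$, $n\in\mathbb{N}$; $\Omega(S)$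 is the unique subshift whose set of finite subwords equals $W(S)$. The IHS is $\Omega_n(\omega_0)=\overline{\{m\cdot S^n(\omega_0):m\in\mathbb{Z}\}}$. $G(S)$ is the directed graph on $\mathcal{A}^2$ with an edge $u\to w$ iff $u,w$ are illegal and $w$ is a subword of $S(u)$. $\omega_0$ is a good approximant if every directed path in $G(S)$ starting at a length-$2$ subword of $\omega_0$ contains no closed subpath. $\omega_0$ is periodic if $\omega_0=u^\infty$ for some finite word $u$, i.e. $\omega_0(n)$ depends only on $n$ mod $|u|$. *)

theory Defs
  imports "HOL-Analysis.Analysis" "HOL-Library.Sublist"
begin

text \<open>Configurations are maps int => 'a over a finite alphabet 'a.
  A substitution is a map S :: 'a => 'a list (with nonempty images).\<close>

type_synonym 'a config = "int \<Rightarrow> 'a"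

definition shift :: "int \<Rightarrow> 'a config \<Rightarrow> 'a config" where
  "shift m \<omega> = (\<lambda>n. \<omega> (n - m))"

definition cdist :: "'a config \<Rightarrow> 'a config \<Rightarrow> real" where
  "cdist \<omega>1 \<omega>2 = Inf {1 / (real r + 1) | r :: nat.
      \<forall>n::int. - int r < n \<and> n < int r \<longrightarrow> \<omega>1 n = \<omega>2 n}"

definition cclosure :: "'a config set \<Rightarrow> 'a config set" where
  "cclosure A = {\<omega>. \<forall>\<epsilon>>0. \<exists>\<omega>'\<in>A. cdist \<omega> \<omega>' < \<epsilon>}"

definition subshift :: "'a config set \<Rightarrow> bool" where
  "subshift X \<longleftrightarrow> X \<noteq> {} \<and> cclosure X \<subseteq> X \<and> (\<forall>m. \<forall>\<omega>\<in>X. shift m \<omega> \<in> X)"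

definition hausdorff_dist :: "'a config set \<Rightarrow> 'a config set \<Rightarrow> real" where
  "hausdorff_dist X Y = max (Sup ((\<lambda>x. Inf ((\<lambda>y. cdist x y) ` Y)) ` X))
                            (Sup ((\<lambda>y. Inf ((\<lambda>x. cdist x y) ` X)) ` Y))"

definition conf_subwords :: "'a config \<Rightarrow> 'a list set" where
  "conf_subwords \<omega> = {map (\<lambda>i. \<omega> (m + int i)) [0..<k] | m k. True}"

definition lang :: "'a config set \<Rightarrow> 'a list set" where
  "lang X = (\<Union>\<omega>\<in>X. conf_subwords \<omega>)"

definition subst_word :: "('a \<Rightarrow> 'a list) \<Rightarrow> 'a list \<Rightarrow> 'a list" where
  "subst_word S w = concat (map S w)"

text \<open>Starting position of the block S(omega k) in S(omega); S(omega 0) starts at 0.\<close>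
definition block_pos :: "('a \<Rightarrow> 'a list) \<Rightarrow> 'a config \<Rightarrow> int \<Rightarrow> int" where
  "block_pos S \<omega> k = (if 0 \<le> k then (\<Sum>j\<in>{0..<k}. int (length (S (\<omega> j))))
                       else - (\<Sum>j\<in>{k..<0}. int (length (S (\<omega> j)))))"

definition subst_conf :: "('a \<Rightarrow> 'a list) \<Rightarrow> 'a config \<Rightarrow> 'a config" where
  "subst_conf S \<omega> = (\<lambda>n. let k = (THE k. block_pos S \<omega> k \<le> n \<and> n < block_pos S \<omega> (k + 1))
                         in S (\<omega> k) ! nat (n - block_pos S \<omega> k))"

definition primitive :: "('a \<Rightarrow> 'a list) \<Rightarrow> bool" where
  "primitive S \<longleftrightarrow> (\<exists>p. \<forall>a b. b \<in> set ((subst_word S ^^ p) [a]))"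

definition subst_matrix :: "('a::finite \<Rightarrow> 'a list) \<Rightarrow> complex ^'a ^'a" where
  "subst_matrix S = (\<chi> i j. of_nat (count_list (S j) i))"

definition pf_eigenvalue :: "('a::finite \<Rightarrow> 'a list) \<Rightarrow> real" where
  "pf_eigenvalue S = Max {cmod z | z. \<exists>v :: complex ^'a. v \<noteq> 0 \<and> subst_matrix S *v v = z *s v}"

definition legal_words :: "('a \<Rightarrow> 'a list) \<Rightarrow> 'a list set" where
  "legal_words S = {u. \<exists>a n. sublist u ((subst_word S ^^ n) [a])}"

definition subst_shift :: "('a \<Rightarrow> 'a list) \<Rightarrow> 'a config set" where
  "subst_shift S = (THE X. subshift X \<and> lang X = legal_words S)"

definition IHS :: "('a \<Rightarrow> 'a list) \<Rightarrow> nat \<Rightarrow> 'a config \<Rightarrow> 'a config set" where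
  "IHS S n \<omega>0 = cclosure {shift m ((subst_conf S ^^ n) \<omega>0) | m. True}"

definition G_edge :: "('a \<Rightarrow> 'a list) \<Rightarrow> 'a list \<Rightarrow> 'a list \<Rightarrow> bool" where
  "G_edge S u w \<longleftrightarrow> length u = 2 \<and> length w = 2 \<and> u \<notin> legal_words S \<and> w \<notin> legal_words S
       \<and> sublist w (subst_word S u)"

definition good_approximant :: "('a \<Rightarrow> 'a list) \<Rightarrow> 'a config \<Rightarrow> bool" where
  "good_approximant S \<omega>0 \<longleftrightarrow>
     (\<forall>vs. vs \<noteq> [] \<and> hd vs \<in> conf_subwords \<omega>0 \<and> length (hd vs) = 2
        \<and> (\<forall>i. Suc i < length vs \<longrightarrow> G_edge S (vs ! i) (vs ! Suc i)) \<longrightarrow> distinct vs)"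

definition periodic_conf :: "'a config \<Rightarrow> bool" where
  "periodic_conf \<omega> \<longleftrightarrow> (\<exists>u. u \<noteq> [] \<and> (\<forall>n. \<omega> n = u ! nat (n mod int (length u))))"

end

theory Submission
  imports Defs "HOL-Computational_Algebra.Polynomial"
begin

text \<open>
  Both subshifts are determined by their languages, and the Hausdorff distance is governed by
  the length up to which these languages agree.

  Upper bound: a path in the graph of illegal pairs starting in a good approximant has distinct
  vertices, so after \<open>CARD('a)\<^sup>2\<close> substitution steps only legal pairs are left. Every word that is not
  longer than the shortest \<open>S^m(a)\<close> lies in \<open>S^m(ab)\<close> for some pair \<open>ab\<close>, and some \<open>S^q(c)\<close> contains
  all legal pairs; hence the languages agree up to a length comparable to \<open>\<theta>^n\<close>.

  Lower bound: \<open>S^n(u^\<infinity>)\<close> has at most \<open>P = |S^n(u)|\<close> words of length \<open>P\<close>, whereas an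
  infinite subshift has more than \<open>P\<close> of them by Morse--Hedlund; and \<open>P\<close> is at most
  of order \<open>\<theta>^n\<close>.

  The growth of \<open>|S^n(a)|\<close> is read off a positive left eigenvector of the substitution matrix,
  which Brouwer's fixed point theorem on the simplex provides. Pairing with it also shows that no
  eigenvalue has larger modulus.
\<close>

section \<open>Words of configurations and the Hausdorff distance\<close>

definition word_at :: "'a config \<Rightarrow> int \<Rightarrow> nat \<Rightarrow> 'a list" where
  "word_at \<omega> m k = map (\<lambda>i. \<omega> (m + int i)) [0..<k]"

lemma length_word_at [simp]: "length (word_at \<omega> m k) = k"
  by (simp add: word_at_def)

lemma nth_word_at [simp]: "i < k \<Longrightarrow> word_at \<omega> m k ! i = \<omega> (m + int i)"
  by (simp add: word_at_def)

lemma word_at_eq_iff: "word_at \<omega> m k = w \<longleftrightarrow> length w = k \<and> (\<forall>i<k. w ! i = \<omega> (m + int i))"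
  by (auto simp: list_eq_iff_nth_eq)

lemma word_at_0 [simp]: "word_at \<omega> m 0 = []"
  by (simp add: word_at_def)

lemma word_at_add: "word_at \<omega> m (j + k) = word_at \<omega> m j @ word_at \<omega> (m + int j) k"
  by (auto simp: word_at_eq_iff nth_append)

lemma word_at_shift: "word_at (shift s \<omega>) m k = word_at \<omega> (m - s) k"
  by (simp add: word_at_eq_iff shift_def algebra_simps)

lemma conf_subwords_word_at: "conf_subwords \<omega> = {word_at \<omega> m k | m k. True}"
  by (simp add: conf_subwords_def word_at_def)

lemma word_at_in_conf_subwords [simp]: "word_at \<omega> m k \<in> conf_subwords \<omega>"
  by (auto simp: conf_subwords_word_at)

lemma conf_subwordsE:
  assumes "w \<in> conf_subwords \<omega>"
  obtains m where "w = word_at \<omega> m (length w)"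
  using assms by (auto simp: conf_subwords_word_at)

lemma sublist_word_at:
  assumes "sublist w (word_at \<omega> m k)"
  obtains j where "w = word_at \<omega> (m + int j) (length w)" "j + length w \<le> k"
proof -
  from assms obtain ps ss where eq: "word_at \<omega> m k = ps @ w @ ss"
    by (auto simp: sublist_def)
  have k: "k = length ps + (length w + length ss)"
    using arg_cong[OF eq, of length] by simp
  have "w = word_at \<omega> (m + int (length ps)) (length w)"
    using eq unfolding k word_at_add by simp
  then show thesis using k by (intro that) auto
qed

lemma conf_subwords_sublist: "v \<in> conf_subwords \<omega> \<Longrightarrow> sublist w v \<Longrightarrow> w \<in> conf_subwords \<omega>"
  by (metis conf_subwordsE sublist_word_at word_at_in_conf_subwords)

lemma word_at_sublist_word_at:
  assumes "m' \<le> m" "m + int k \<le> m' + int k'"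
  shows "sublist (word_at \<omega> m k) (word_at \<omega> m' k')"
proof -
  have "k' = nat (m - m') + (k + nat (m' + int k' - (m + int k)))"
    using assms by auto
  then have "word_at \<omega> m' k' = word_at \<omega> m' (nat (m - m')) @ word_at \<omega> m k
      @ word_at \<omega> (m + int k) (nat (m' + int k' - (m + int k)))"
    using assms by (metis word_at_add add.commute diff_add_cancel int_nat_eq diff_ge_0_iff_ge)
  then show ?thesis by (auto simp: sublist_def)
qed

lemma conf_subwords_shift [simp]: "conf_subwords (shift s \<omega>) = conf_subwords \<omega>"
proof -
  have "word_at \<omega> m k \<in> conf_subwords (shift s \<omega>)" for m k
    using word_at_in_conf_subwords[of "shift s \<omega>" "m + s" k] by (simp add: word_at_shift)
  then show ?thesis by (auto simp: conf_subwords_word_at word_at_shift)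
qed

text \<open>The open interval \<open>(-r,r)\<close> holds the \<open>2 * r - 1\<close> integers from
  \<open>1 - r\<close> on. For \<open>r = 0\<close> truncated subtraction yields the empty word,
  matching the empty condition on the left.\<close>

lemma agree_iff_word_at:
  "(\<forall>n::int. - int r < n \<and> n < int r \<longrightarrow> x n = y n)
    \<longleftrightarrow> word_at x (1 - int r) (2 * r - 1) = word_at y (1 - int r) (2 * r - 1)" (is "?L \<longleftrightarrow> ?R")
proof
  assume ?L then show ?R by (auto simp: word_at_eq_iff)
next
  assume R: ?R
  show ?L
  proof (intro allI impI)
    fix n :: int assume n: "- int r < n \<and> n < int r"
    then have "nat (n - (1 - int r)) < 2 * r - 1" "1 - int r + int (nat (n - (1 - int r))) = n"
      by auto
    with R show "x n = y n" by (metis nth_word_at)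
  qed
qed

section \<open>The metric and closures seen through central windows\<close>

lemma cdist_le:
  assumes "word_at x (1 - int r) (2 * r - 1) = word_at y (1 - int r) (2 * r - 1)"
  shows "cdist x y \<le> 1 / (real r + 1)"
  unfolding cdist_def agree_iff_word_at using assms
  by (intro cInf_lower bdd_belowI[of _ 0]) auto

lemma cdist_set_nonempty:
  "{1 / (real r + 1) | r :: nat. word_at x (1 - int r) (2 * r - 1) = word_at y (1 - int r) (2 * r - 1)} \<noteq> {}"
  using word_at_0 by (auto intro!: exI[of _ "0::nat"])

lemma cdist_nonneg: "0 \<le> cdist x y"
  unfolding cdist_def agree_iff_word_at
  by (rule cInf_greatest[OF cdist_set_nonempty]) auto

lemma cdist_le_1: "cdist x y \<le> 1"
  using cdist_le[of x 0 y] by simp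

lemma cdist_less_iff:
  "cdist x y < \<epsilon> \<longleftrightarrow> (\<exists>r. 1 / (real r + 1) < \<epsilon> \<and>
      word_at x (1 - int r) (2 * r - 1) = word_at y (1 - int r) (2 * r - 1))"
  unfolding cdist_def agree_iff_word_at
  by (subst cInf_less_iff[OF cdist_set_nonempty]) (auto intro: bdd_belowI[of _ 0])

text \<open>A disagreement on \<open>(-r,r)\<close> persists on every larger window, so only radii
  \<open>s < r\<close> compete in the infimum, and \<open>1/(s+1) \<ge> 1/r\<close> for
  these.\<close>

lemma cdist_ge:
  assumes "r > 0" "word_at x (1 - int r) (2 * r - 1) \<noteq> word_at y (1 - int r) (2 * r - 1)"
  shows "1 / real r \<le> cdist x y"
  unfolding cdist_def agree_iff_word_at
proof (rule cInf_greatest[OF cdist_set_nonempty], safe)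
  fix s assume eq: "word_at x (1 - int s) (2 * s - 1) = word_at y (1 - int s) (2 * s - 1)"
  have "s < r"
  proof (rule ccontr)
    assume "\<not> s < r"
    then have "word_at x (1 - int r) (2 * r - 1) = word_at y (1 - int r) (2 * r - 1)"
      using eq[folded agree_iff_word_at] unfolding agree_iff_word_at[symmetric] by auto
    with assms show False by blast
  qed
  then show "1 / real r \<le> 1 / (real s + 1)"
    using assms(1) by (intro divide_left_mono) auto
qed

text \<open>The cylinders over the windows \<open>(-r,r)\<close> form a neighbourhood basis, which
  makes closures a purely combinatorial matter.\<close>

lemma mem_cclosure_iff:
  "x \<in> cclosure A \<longleftrightarrow>
    (\<forall>r. \<exists>y\<in>A. word_at x (1 - int r) (2 * r - 1) = word_at y (1 - int r) (2 * r - 1))" (is "?L \<longleftrightarrow> ?R")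
proof
  assume L: ?L
  show ?R
  proof
    fix r
    \<comment> \<open>For \<open>r > 0\<close> the radius \<open>1/(r+1)\<close> lies strictly below
      \<open>1/r\<close>, the least distance possible after a disagreement on
      \<open>(-r,r)\<close>.\<close>
    from L obtain y where "y \<in> A" "cdist x y < 1 / real (Suc r)"
      unfolding cclosure_def by (auto dest!: spec[of _ "1 / real (Suc r)"])
    moreover have "word_at x (1 - int r) (2 * r - 1) = word_at y (1 - int r) (2 * r - 1)"
    proof (rule ccontr)
      assume ne: "\<not> ?thesis"
      then have "r > 0" by (cases r) auto
      then have "1 / real (Suc r) \<le> 1 / real r"
        by (intro divide_left_mono) auto
      with cdist_ge[OF \<open>r > 0\<close> ne] \<open>cdist x y < 1 / real (Suc r)\<close> show False by linarith
    qed
    ultimately show "\<exists>y\<in>A. word_at x (1 - int r) (2 * r - 1) = word_at y (1 - int r) (2 * r - 1)"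
      by blast
  qed
next
  assume R: ?R
  show ?L
    unfolding cclosure_def
  proof (intro CollectI allI impI)
    fix \<epsilon> :: real assume "\<epsilon> > 0"
    then obtain r :: nat where "1 / (real r + 1) < \<epsilon>"
      by (metis Suc_eq_plus1 add.commute of_nat_Suc nat_approx_posE)
    with R show "\<exists>\<omega>'\<in>A. cdist x \<omega>' < \<epsilon>"
      unfolding cdist_less_iff by blast
  qed
qed

section \<open>Subshifts described by their languages\<close>

text \<open>If \<open>L\<close> is nonempty, closed under subwords and extendable on both sides,
  this is the unique subshift with language \<open>L\<close>. Orbit closures and, for growing
  substitutions, \<open>subst_shift S\<close> both take this form.\<close>

definition lang_shift :: "'a list set \<Rightarrow> 'a config set" where
  "lang_shift L = {\<omega>. conf_subwords \<omega> \<subseteq> L}"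

lemma shift_in_lang_shift [simp]: "shift m \<omega> \<in> lang_shift L \<longleftrightarrow> \<omega> \<in> lang_shift L"
  by (simp add: lang_shift_def)

lemma lang_lang_shift_subset: "lang (lang_shift L) \<subseteq> L"
  by (auto simp: lang_def lang_shift_def)

lemma lang_lang_shift_conf_subwords [simp]:
  "lang (lang_shift (conf_subwords \<omega>)) = conf_subwords \<omega>"
  by (auto simp: lang_def lang_shift_def)

text \<open>Any finite word of \<open>x\<close> sits inside a large enough central window, and
  \<open>L\<close> is closed under subwords.\<close>

lemma conf_subwords_subset_if_all_windows:
  assumes "\<And>r. word_at x (1 - int r) (2 * r - 1) \<in> L"
    and "\<And>v w. v \<in> L \<Longrightarrow> sublist w v \<Longrightarrow> w \<in> L"
  shows "conf_subwords x \<subseteq> L"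
proof
  fix w assume "w \<in> conf_subwords x"
  then obtain m where m: "w = word_at x m (length w)" by (rule conf_subwordsE)
  define r where "r = nat \<bar>m\<bar> + length w + 1"
  have "sublist (word_at x m (length w)) (word_at x (1 - int r) (2 * r - 1))"
    by (rule word_at_sublist_word_at) (auto simp: r_def)
  with m assms show "w \<in> L" by metis
qed

text \<open>A window that occurs anywhere in \<open>\<omega>\<close> is brought to the centre by a
  shift; so being a limit of shifts of \<open>\<omega>\<close> amounts to having no words foreign to
  \<open>\<omega>\<close>.\<close>

lemma cclosure_orbit: "cclosure {shift m \<omega> | m. True} = lang_shift (conf_subwords \<omega>)"
proof (intro set_eqI iffI)
  fix x assume x: "x \<in> cclosure {shift m \<omega> | m. True}"
  have "conf_subwords x \<subseteq> conf_subwords \<omega>"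
  proof (rule conf_subwords_subset_if_all_windows)
    fix r
    from x obtain m where "word_at x (1 - int r) (2 * r - 1) = word_at (shift m \<omega>) (1 - int r) (2 * r - 1)"
      unfolding mem_cclosure_iff by blast
    then show "word_at x (1 - int r) (2 * r - 1) \<in> conf_subwords \<omega>"
      unfolding word_at_shift by (metis word_at_in_conf_subwords)
  qed (rule conf_subwords_sublist)
  then show "x \<in> lang_shift (conf_subwords \<omega>)" by (simp add: lang_shift_def)
next
  fix x assume x: "x \<in> lang_shift (conf_subwords \<omega>)"
  show "x \<in> cclosure {shift m \<omega> | m. True}"
    unfolding mem_cclosure_iff
  proof
    fix r
    let ?w = "word_at x (1 - int r) (2 * r - 1)"
    have "?w \<in> conf_subwords \<omega>" using x by (auto simp: lang_shift_def)
    then obtain m where "?w = word_at \<omega> m (2 * r - 1)" by (metis conf_subwordsE length_word_at)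
    then have "?w = word_at (shift (1 - int r - m) \<omega>) (1 - int r) (2 * r - 1)"
      by (simp add: word_at_shift)
    then show "\<exists>y\<in>{shift m \<omega> | m. True}. ?w = word_at y (1 - int r) (2 * r - 1)" by blast
  qed
qed

lemma IHS_eq_lang_shift: "IHS S n \<omega> = lang_shift (conf_subwords ((subst_conf S ^^ n) \<omega>))"
  unfolding IHS_def by (rule cclosure_orbit)

lemma obtain_word_in_lang:
  assumes inv: "\<forall>m. \<forall>x\<in>X. shift m x \<in> X" and "w \<in> lang X"
  obtains y where "y \<in> X" "word_at y m (length w) = w"
proof -
  from assms(2) obtain z where "z \<in> X" "w \<in> conf_subwords z" by (auto simp: lang_def)
  then obtain k where "w = word_at z k (length w)" by (metis conf_subwordsE)
  then have "word_at (shift (m - k) z) m (length w) = w" by (simp add: word_at_shift)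
  with inv \<open>z \<in> X\<close> that show thesis by blast
qed

text \<open>Shift invariance places any word of \<open>L\<close> in the central window of a point of
  \<open>X\<close>, and closedness of \<open>X\<close> turns agreement on all windows into
  membership. This settles uniqueness in the definition of \<open>subst_shift\<close>.\<close>

lemma subshift_unique:
  assumes X: "subshift X" "lang X = L" and L: "lang (lang_shift L) = L"
  shows "X = lang_shift L"
proof
  show "X \<subseteq> lang_shift L" using X by (auto simp: lang_shift_def lang_def)
  have inv: "\<forall>m. \<forall>x\<in>X. shift m x \<in> X" using X(1) by (simp add: subshift_def)
  have "x \<in> cclosure X" if x: "x \<in> lang_shift L" for x
    unfolding mem_cclosure_iff
  proof
    fix r
    let ?w = "word_at x (1 - int r) (2 * r - 1)"
    have "?w \<in> lang X" using x X by (auto simp: lang_shift_def)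
    then obtain y where "y \<in> X" "word_at y (1 - int r) (length ?w) = ?w"
      by (rule obtain_word_in_lang[OF inv, where m = "1 - int r"])
    then show "\<exists>y\<in>X. ?w = word_at y (1 - int r) (2 * r - 1)"
      unfolding length_word_at by (intro bexI[of _ y]) simp_all
  qed
  then show "lang_shift L \<subseteq> X" using X by (auto simp: subshift_def)
qed

lemma subshift_lang_shift:
  assumes "lang_shift L \<noteq> {}" and sub: "\<And>v w. v \<in> L \<Longrightarrow> sublist w v \<Longrightarrow> w \<in> L"
  shows "subshift (lang_shift L)"
proof -
  have "x \<in> lang_shift L" if "x \<in> cclosure (lang_shift L)" for x
  proof -
    have "conf_subwords x \<subseteq> L"
    proof (rule conf_subwords_subset_if_all_windows)
      fix r
      from that obtain y where "y \<in> lang_shift L"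
        "word_at x (1 - int r) (2 * r - 1) = word_at y (1 - int r) (2 * r - 1)"
        unfolding mem_cclosure_iff by blast
      then show "word_at x (1 - int r) (2 * r - 1) \<in> L"
        by (auto simp: lang_shift_def)
    qed (rule sub)
    then show ?thesis by (simp add: lang_shift_def)
  qed
  with assms show ?thesis by (auto simp: subshift_def)
qed

section \<open>Hausdorff distance in terms of languages\<close>

text \<open>Bounds the sets whose suprema form \<open>hausdorff_dist\<close>; a real supremum
  dominates its members only for bounded sets.\<close>

lemma Inf_cdist_le_1:
  assumes "X \<noteq> {}"
  shows "(INF x\<in>X. cdist x y) \<le> 1"
proof -
  from assms obtain x where "x \<in> X" by blast
  then have "(INF x\<in>X. cdist x y) \<le> cdist x y"
    by (intro cINF_lower bdd_belowI2[of _ 0] cdist_nonneg)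
  also have "\<dots> \<le> 1" by (rule cdist_le_1)
  finally show ?thesis .
qed

text \<open>Comparing the languages at one length suffices: the window \<open>(-r,r)\<close> of a
  point of one set is a word of the other language, hence the window of a point there.\<close>

lemma hausdorff_dist_le:
  assumes ne: "X \<noteq> {}" "Y \<noteq> {}"
    and inv: "\<forall>m. \<forall>x\<in>X. shift m x \<in> X" "\<forall>m. \<forall>y\<in>Y. shift m y \<in> Y"
    and eq: "\<And>w. length w = 2 * r - 1 \<Longrightarrow> w \<in> lang X \<longleftrightarrow> w \<in> lang Y"
  shows "hausdorff_dist X Y \<le> 1 / (real r + 1)"
proof -
  have "(INF y\<in>Y. cdist x y) \<le> 1 / (real r + 1)" if "x \<in> X" for x
  proof -
    let ?w = "word_at x (1 - int r) (2 * r - 1)"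
    have "?w \<in> lang X" using that unfolding lang_def by (intro UN_I) auto
    then have "?w \<in> lang Y" using eq[of ?w] by simp
    then obtain y where y: "y \<in> Y" "word_at y (1 - int r) (length ?w) = ?w"
      by (rule obtain_word_in_lang[OF inv(2), where m = "1 - int r"])
    have "(INF y\<in>Y. cdist x y) \<le> cdist x y"
      using y by (intro cINF_lower bdd_belowI2[of _ 0] cdist_nonneg)
    also have "\<dots> \<le> 1 / (real r + 1)" using y by (intro cdist_le) simp
    finally show ?thesis .
  qed
  moreover have "(INF x\<in>X. cdist x y) \<le> 1 / (real r + 1)" if "y \<in> Y" for y
  proof -
    let ?w = "word_at y (1 - int r) (2 * r - 1)"
    have "?w \<in> lang Y" using that unfolding lang_def by (intro UN_I) auto
    then have "?w \<in> lang X" using eq[of ?w] by simp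
    then obtain x where x: "x \<in> X" "word_at x (1 - int r) (length ?w) = ?w"
      by (rule obtain_word_in_lang[OF inv(1), where m = "1 - int r"])
    have "(INF x\<in>X. cdist x y) \<le> cdist x y"
      using x by (intro cINF_lower bdd_belowI2[of _ 0] cdist_nonneg)
    also have "\<dots> \<le> 1 / (real r + 1)" using x by (intro cdist_le) simp
    finally show ?thesis .
  qed
  ultimately show ?thesis
    unfolding hausdorff_dist_def using ne by (auto intro!: cSUP_least)
qed

text \<open>A word of \<open>Y\<close> missing from \<open>X\<close> is put at position
  \<open>1 - r\<close> of some \<open>y\<close>. No point of \<open>X\<close> agrees with this
  \<open>y\<close> on \<open>(-r,r)\<close>, so \<open>y\<close> has distance at least
  \<open>1/r\<close> from all of \<open>X\<close>.\<close>

lemma hausdorff_dist_ge: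
  assumes ne: "X \<noteq> {}"
    and inv: "\<forall>m. \<forall>y\<in>Y. shift m y \<in> Y"
    and w: "w \<in> lang Y" "w \<notin> lang X" and r: "r > 0" "length w \<le> 2 * r - 1"
  shows "1 / real r \<le> hausdorff_dist X Y"
proof -
  obtain y where y: "y \<in> Y" "word_at y (1 - int r) (length w) = w"
    by (rule obtain_word_in_lang[OF inv w(1), where m = "1 - int r"])
  have "1 / real r \<le> cdist x y" if x: "x \<in> X" for x
  proof (rule cdist_ge[OF r(1)])
    show "word_at x (1 - int r) (2 * r - 1) \<noteq> word_at y (1 - int r) (2 * r - 1)"
    proof
      assume "word_at x (1 - int r) (2 * r - 1) = word_at y (1 - int r) (2 * r - 1)"
      moreover have "word_at z (1 - int r) (length w) = take (length w) (word_at z (1 - int r) (2 * r - 1))" for z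
        using r(2) by (auto simp: word_at_eq_iff)
      ultimately have "word_at x (1 - int r) (length w) = w" using y(2) by metis
      then have "w \<in> conf_subwords x" using word_at_in_conf_subwords[of x "1 - int r" "length w"] by simp
      with w(2) x show False by (auto simp: lang_def)
    qed
  qed
  then have "1 / real r \<le> (INF x\<in>X. cdist x y)" using ne by (intro cINF_greatest)
  also have "\<dots> \<le> (SUP y\<in>Y. INF x\<in>X. cdist x y)"
    using y(1) by (intro cSUP_upper bdd_aboveI2[of _ _ 1] Inf_cdist_le_1 ne)
  finally show ?thesis unfolding hausdorff_dist_def by simp
qed

section \<open>The Perron--Frobenius eigenvalue\<close>

text \<open>Brouwer's theorem on the standard simplex \<open>D\<close>, applied to the matrix action
  divided by the coordinate sum \<open>N x\<close> of the image. Every column has a positive entry,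
  so \<open>N\<close> is positive on \<open>D\<close>; its value at the fixed point is the
  eigenvalue.\<close>

lemma nonneg_kernel_eigenvector:
  fixes f :: "'a::finite \<Rightarrow> 'a \<Rightarrow> real"
  assumes nonneg: "\<And>i j. 0 \<le> f i j" and col: "\<And>j. \<exists>i. 0 < f i j"
  obtains x \<mu> where "\<And>i. 0 \<le> x i" "(\<Sum>i\<in>UNIV. x i) = 1"
    "\<And>i. (\<Sum>j\<in>UNIV. f i j * x j) = \<mu> * x i"
proof -
  define D where "D = {x :: real^'a. (\<forall>i. 0 \<le> x $ i) \<and> (\<Sum>i\<in>UNIV. x $ i) = 1}"
  define N where "N x = (\<Sum>i\<in>UNIV. \<Sum>j\<in>UNIV. f i j * x $ j)" for x :: "real^'a"
  define F where "F x = (\<chi> i. (\<Sum>j\<in>UNIV. f i j * x $ j) / N x)" for x :: "real^'a"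
  have N_pos: "0 < N x" if "x \<in> D" for x
  proof -
    have "\<exists>j. 0 < x $ j"
    proof (rule ccontr)
      assume "\<nexists>j. 0 < x $ j"
      then have "(\<Sum>i\<in>UNIV. x $ i) \<le> 0" by (intro sum_nonpos) (auto simp: not_less)
      with that show False by (simp add: D_def)
    qed
    then obtain j i where "0 < x $ j" "0 < f i j" using col by blast
    then have "0 < f i j * x $ j" by simp
    also have "\<dots> \<le> (\<Sum>j\<in>UNIV. f i j * x $ j)"
      using that nonneg by (intro member_le_sum) (auto simp: D_def)
    also have "\<dots> \<le> N x"
      unfolding N_def
      using that nonneg by (intro member_le_sum[of i UNIV "\<lambda>i. \<Sum>j\<in>UNIV. f i j * x $ j"])
        (auto simp: D_def intro!: sum_nonneg)
    finally show ?thesis .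
  qed
  have "convex D"
    unfolding convex_def D_def
    by (auto simp: sum.distrib sum_distrib_left[symmetric])
  moreover have "compact D"
  proof -
    have "closed D"
    proof -
      have "D = (\<Inter>i. {x. 0 \<le> x $ i}) \<inter> {x. (\<Sum>i\<in>UNIV. x $ i) = 1}" by (auto simp: D_def)
      then show ?thesis
        by (auto intro!: closed_INT closed_Int closed_Collect_le closed_Collect_eq continuous_intros)
    qed
    moreover have "norm x \<le> 1" if "x \<in> D" for x
    proof -
      have "norm x \<le> (\<Sum>i\<in>UNIV. \<bar>x $ i\<bar>)" by (rule norm_le_l1_cart)
      also have "\<dots> = 1" using that by (simp add: D_def)
      finally show ?thesis .
    qed
    ultimately show ?thesis by (auto simp: compact_eq_bounded_closed bounded_iff)
  qed
  moreover have "D \<noteq> {}"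
  proof -
    have "(\<chi> i. 1 / real CARD('a)) \<in> D" by (simp add: D_def)
    then show ?thesis by blast
  qed
  moreover have "continuous_on D F"
    unfolding F_def N_def
    by (intro continuous_intros ballI) (use N_pos[unfolded N_def] in force)
  moreover have "F \<in> D \<rightarrow> D"
  proof
    fix x assume x: "x \<in> D"
    have "0 \<le> F x $ i" for i
      unfolding F_def using N_pos[OF x] x nonneg by (auto simp: D_def intro!: divide_nonneg_pos sum_nonneg)
    moreover have "(\<Sum>i\<in>UNIV. F x $ i) = 1"
      using N_pos[OF x] by (simp add: F_def sum_divide_distrib[symmetric]) (simp add: N_def)
    ultimately show "F x \<in> D" by (simp add: D_def)
  qed
  ultimately obtain x where x: "x \<in> D" "F x = x" using brouwer by (metis (no_types) Pi_iff image_subsetI)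
  have "(\<Sum>j\<in>UNIV. f i j * x $ j) = N x * x $ i" for i
    using arg_cong[OF x(2), of "\<lambda>y. y $ i"] N_pos[OF x(1)] by (simp add: F_def field_simps)
  with x(1) show thesis by (intro that[of "\<lambda>i. x $ i" "N x"]) (auto simp: D_def)
qed

text \<open>The \<open>Max\<close> in \<open>pf_eigenvalue\<close> needs a finite set. The
  eigenvalues are the roots of the characteristic polynomial \<open>P\<close>, written with the
  Leibniz formula; a real number beyond the bound is not a root, so \<open>P\<close> is not
  zero.\<close>

lemma finite_eigenvalues:
  fixes A :: "complex^'n^'n"
  assumes bound: "\<And>z v. v \<noteq> 0 \<Longrightarrow> A *v v = z *s v \<Longrightarrow> cmod z \<le> B"
  shows "finite {z. \<exists>v. v \<noteq> 0 \<and> A *v v = z *s v}"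
proof -
  define C where "C z = (\<chi> i j. A $ i $ j - (if i = j then z else 0))" for z
  define P where "P = (\<Sum>p\<in>{p. p permutes (UNIV::'n set)}. of_int (sign p) *
      (\<Prod>i\<in>UNIV. [:A $ i $ p i, - (if i = p i then 1 else 0):]))"
  have P: "poly P z = det (C z)" for z
  proof -
    have "poly [:A $ i $ j, - (if i = j then 1 else 0):] z = C z $ i $ j" for i j
      by (simp add: C_def)
    then show ?thesis
      by (simp only: P_def det_def poly_sum poly_mult poly_prod poly_of_int)
  qed
  have C_mult: "C z *v v = A *v v - z *s v" for z v
    by (simp add: C_def vec_eq_iff matrix_vector_mult_def left_diff_distrib sum_subtractf
        if_distrib[of "\<lambda>x. x * _"] sum.delta cong: if_cong)
  have root_iff: "poly P z = 0 \<longleftrightarrow> (\<exists>v. v \<noteq> 0 \<and> A *v v = z *s v)" for z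
  proof -
    have "poly P z \<noteq> 0 \<longleftrightarrow> (\<forall>v. C z *v v = 0 \<longrightarrow> v = 0)"
      unfolding P invertible_det_nz[symmetric] invertible_left_inverse matrix_left_invertible_ker ..
    then show ?thesis unfolding C_mult by auto
  qed
  have "poly P (of_real (\<bar>B\<bar> + 1)) \<noteq> 0"
    using bound[of _ "of_real (\<bar>B\<bar> + 1)"] unfolding root_iff norm_of_real by force
  then have "P \<noteq> 0" by auto
  then have "finite {z. poly P z = 0}" by (rule poly_roots_finite)
  then show ?thesis by (simp only: root_iff)
qed

section \<open>Iterated substitution of words and weights of letters\<close>

lemma subst_word_simps [simp]:
  "subst_word S [] = []" "subst_word S (a # w) = S a @ subst_word S w"
  "subst_word S (u @ w) = subst_word S u @ subst_word S w"
  by (simp_all add: subst_word_def)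

lemma subst_word_pow_append [simp]:
  "(subst_word S ^^ n) (u @ w) = (subst_word S ^^ n) u @ (subst_word S ^^ n) w"
  by (induction n) auto

lemma subst_word_pow_Nil [simp]: "(subst_word S ^^ n) [] = []"
  by (induction n) auto

lemma subst_word_pow_Cons:
  "(subst_word S ^^ n) (a # w) = (subst_word S ^^ n) [a] @ (subst_word S ^^ n) w"
  using subst_word_pow_append[of n S "[a]" w] by simp

text \<open>Translates matrix products into weights of words, so that a left eigenvector of the
  substitution matrix becomes a weight on letters.\<close>

lemma sum_count_list:
  fixes v :: "'a::finite \<Rightarrow> real"
  shows "(\<Sum>a\<in>UNIV. real (count_list w a) * v a) = sum_list (map v w)"
proof (induction w)
  case (Cons b w)
  have "(\<Sum>a\<in>UNIV. real (count_list (b # w) a) * v a)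
      = (\<Sum>a\<in>UNIV. real (count_list w a) * v a + (if a = b then v a else 0))"
    by (intro sum.cong) (auto simp: algebra_simps)
  with Cons show ?case by (simp add: sum.distrib)
qed simp

text \<open>A left eigenvector acts as a length function that each substitution step scales by
  exactly \<open>\<mu>\<close>.\<close>

lemma sum_list_subst_word_pow:
  fixes v :: "'a \<Rightarrow> real"
  assumes "\<And>a. sum_list (map v (S a)) = \<mu> * v a"
  shows "sum_list (map v ((subst_word S ^^ n) w)) = \<mu> ^ n * sum_list (map v w)"
proof (induction n)
  case (Suc n)
  have "sum_list (map v (subst_word S u)) = \<mu> * sum_list (map v u)" for u
    by (induction u) (auto simp: assms algebra_simps)
  with Suc show ?case by simp
qed simp

lemma primitive_letter_occurs:
  fixes S :: "'a \<Rightarrow> 'a list"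
  assumes "\<forall>a. S a \<noteq> []" "primitive S"
  shows "\<exists>a. b \<in> set (S a)"
proof -
  from assms(2) obtain p where p: "\<And>a b. b \<in> set ((subst_word S ^^ p) [a])"
    unfolding primitive_def by blast
  show ?thesis
  proof (cases p)
    \<comment> \<open>Primitivity with exponent 0 forces a one-letter alphabet.\<close>
    case 0
    then have "b = hd (S b)" using p[of b "hd (S b)"] p[of b b] p by auto
    then show ?thesis using assms(1)[rule_format, of b] hd_in_set by metis
  next
    case (Suc q)
    then show ?thesis using p[of b b] by (auto simp: subst_word_def)
  qed
qed

text \<open>A left eigenvector \<open>v\<close> is positive by primitivity. Pairing it with a right
  eigenvector \<open>u\<close> identifies the two eigenvalues, and pairing it with the moduli of an
  arbitrary eigenvector bounds every other eigenvalue by the same number.\<close>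

lemma perron_frobenius:
  fixes S :: "'a::finite \<Rightarrow> 'a list"
  assumes ne: "\<forall>a. S a \<noteq> []" and prim: "primitive S"
  shows "\<exists>v. \<forall>a. 0 < v a \<and> sum_list (map v (S a)) = pf_eigenvalue S * v a"
    and "1 \<le> pf_eigenvalue S"
proof -
  \<comment> \<open>The row index is the letter being substituted: this is the transposed matrix,
    and \<open>v\<close> is a left eigenvector of \<open>subst_matrix S\<close>.\<close>
  obtain v :: "'a \<Rightarrow> real" and \<mu> where v: "\<And>i. 0 \<le> v i" "(\<Sum>i\<in>UNIV. v i) = 1"
      "\<And>i. (\<Sum>j\<in>UNIV. real (count_list (S i) j) * v j) = \<mu> * v i"
  proof (rule nonneg_kernel_eigenvector[of "\<lambda>i j. real (count_list (S i) j)"])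
    show "\<exists>i. 0 < real (count_list (S i) j)" for j
      using primitive_letter_occurs[OF ne prim, of j] by (auto simp: count_list_0_iff neq0_conv[symmetric] simp del: neq0_conv)
  qed auto
  then have eig: "sum_list (map v (S a)) = \<mu> * v a" for a by (simp add: sum_count_list)
  \<comment> \<open>A right eigenvector; it will show that the bound \<open>\<mu>\<close> is
    attained by an eigenvalue.\<close>
  obtain u :: "'a \<Rightarrow> real" and \<mu>' where u: "\<And>i. 0 \<le> u i" "(\<Sum>i\<in>UNIV. u i) = 1"
      "\<And>i. (\<Sum>j\<in>UNIV. real (count_list (S j) i) * u j) = \<mu>' * u i"
  proof (rule nonneg_kernel_eigenvector[of "\<lambda>i j. real (count_list (S j) i)"])
    show "\<exists>i. 0 < real (count_list (S j) i)" for j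
      using hd_in_set[OF ne[rule_format, of j]] by (auto simp: count_list_0_iff neq0_conv[symmetric] simp del: neq0_conv)
  qed auto
  have ex_pos: "\<exists>a. 0 < x a" if "(\<Sum>i\<in>UNIV. x i) = (1::real)" for x :: "'a \<Rightarrow> real"
  proof (rule ccontr)
    assume "\<nexists>a. 0 < x a"
    then have "(\<Sum>i\<in>UNIV. x i) \<le> 0" by (intro sum_nonpos) (auto simp: not_less)
    with that show False by simp
  qed
  \<comment> \<open>Some letter \<open>b\<close> has positive weight and occurs in a power of
    \<open>S\<close> applied to \<open>a\<close>, whose total weight is
    \<open>\<mu> ^ p * v a\<close>.\<close>
  have v_pos: "0 < v a" for a
  proof -
    obtain b where b: "0 < v b" using ex_pos v by blast
    obtain p where "b \<in> set ((subst_word S ^^ p) [a])" using prim unfolding primitive_def by blast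
    then have "v b \<le> sum_list (map v ((subst_word S ^^ p) [a]))"
      using v(1) by (intro member_le_sum_list) auto
    also have "\<dots> = \<mu> ^ p * v a" by (simp add: sum_list_subst_word_pow[OF eig])
    finally have "v a \<noteq> 0" using b by auto
    with v(1)[of a] show ?thesis by simp
  qed
  have pairing: "(\<Sum>i\<in>UNIV. v i * (\<Sum>j\<in>UNIV. real (count_list (S j) i) * x j))
      = \<mu> * (\<Sum>j\<in>UNIV. v j * x j)" for x :: "'a \<Rightarrow> real"
  proof -
    have "(\<Sum>i\<in>UNIV. v i * (\<Sum>j\<in>UNIV. real (count_list (S j) i) * x j))
        = (\<Sum>j\<in>UNIV. (\<Sum>i\<in>UNIV. real (count_list (S j) i) * v i) * x j)"
      unfolding sum_distrib_left sum_distrib_right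
      by (subst sum.swap) (simp add: mult_ac)
    also have "\<dots> = \<mu> * (\<Sum>j\<in>UNIV. v j * x j)"
      unfolding v(3) by (simp add: sum_distrib_left mult_ac)
    finally show ?thesis .
  qed
  have pos_pairing: "0 < (\<Sum>j\<in>UNIV. v j * x j)" if "\<And>i. 0 \<le> x i" "0 < x a" for x and a
    using v_pos v(1) that by (intro sum_pos2[of _ a]) auto
  have "\<mu>' = \<mu>"
  proof -
    have "\<mu>' * (\<Sum>j\<in>UNIV. v j * u j) = \<mu> * (\<Sum>j\<in>UNIV. v j * u j)"
      using pairing[of u] unfolding u(3) by (simp add: sum_distrib_left mult_ac)
    moreover obtain a where "0 < u a" using ex_pos u(2) by blast
    ultimately show ?thesis using pos_pairing[of u a] u(1) by simp
  qed
  have "1 \<le> \<mu>"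
  proof -
    \<comment> \<open>The column sums of the matrix are the lengths of the words \<open>S j\<close>,
      all at least 1; summing the eigenvalue equation of \<open>u\<close> over the rows then gives
      \<open>\<mu>\<close>.\<close>
    have "1 = (\<Sum>j\<in>UNIV. 1 * u j)" using u by simp
    also have "\<dots> \<le> (\<Sum>j\<in>UNIV. real (length (S j)) * u j)"
    proof (intro sum_mono mult_right_mono)
      show "1 \<le> real (length (S j))" for j using ne[rule_format, of j] by (cases "S j") auto
    qed (use u in auto)
    also have "\<dots> = (\<Sum>j\<in>UNIV. \<Sum>i\<in>UNIV. real (count_list (S j) i) * u j)"
    proof (rule sum.cong)
      fix j
      have "real (length (S j)) = (\<Sum>i\<in>UNIV. real (count_list (S j) i))"
        using sum_count_list[of "S j" "\<lambda>_. 1"] by (simp add: sum_list_triv)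
      then show "real (length (S j)) * u j = (\<Sum>i\<in>UNIV. real (count_list (S j) i) * u j)"
        by (simp add: sum_distrib_right)
    qed simp
    also have "\<dots> = \<mu>" using u \<open>\<mu>' = \<mu>\<close>
      by (subst sum.swap) (simp add: sum_distrib_left[symmetric])
    finally show ?thesis .
  qed
  let ?M = "subst_matrix S"
  have bound: "cmod z \<le> \<mu>" if w: "w \<noteq> 0" "?M *v w = z *s w" for z w
  proof -
    obtain a where a: "w $ a \<noteq> 0" using w(1) by (auto simp: vec_eq_iff)
    \<comment> \<open>Triangle inequality in each row of the eigenvalue equation. Pairing with
      \<open>v\<close> and cancelling a positive sum leaves
      \<open>cmod z \<le> \<mu>\<close>.\<close>
    have le: "cmod z * cmod (w $ i) \<le> (\<Sum>j\<in>UNIV. real (count_list (S j) i) * cmod (w $ j))" for i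
    proof -
      have "z * w $ i = (\<Sum>j\<in>UNIV. of_nat (count_list (S j) i) * w $ j)"
        using arg_cong[OF w(2), of "\<lambda>x. x $ i"]
        by (simp add: matrix_vector_mult_def subst_matrix_def)
      then have "cmod z * cmod (w $ i) = cmod (\<Sum>j\<in>UNIV. of_nat (count_list (S j) i) * w $ j)"
        by (metis norm_mult)
      also have "\<dots> \<le> (\<Sum>j\<in>UNIV. cmod (of_nat (count_list (S j) i) * w $ j))" by (rule norm_sum)
      finally show ?thesis by (simp add: norm_mult)
    qed
    have "cmod z * (\<Sum>i\<in>UNIV. v i * cmod (w $ i)) = (\<Sum>i\<in>UNIV. v i * (cmod z * cmod (w $ i)))"
      by (simp add: sum_distrib_left mult_ac)
    also have "\<dots> \<le> \<mu> * (\<Sum>i\<in>UNIV. v i * cmod (w $ i))"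
      unfolding pairing[symmetric] using le v(1) by (intro sum_mono mult_left_mono) auto
    finally show ?thesis using pos_pairing[of "\<lambda>i. cmod (w $ i)" a] a by simp
  qed
  have "pf_eigenvalue S = \<mu>"
    unfolding pf_eigenvalue_def
  proof (rule Max_eqI)
    have "{cmod z | z. \<exists>v. v \<noteq> 0 \<and> ?M *v v = z *s v} = cmod ` {z. \<exists>v. v \<noteq> 0 \<and> ?M *v v = z *s v}"
      by blast
    moreover have "finite {z. \<exists>v. v \<noteq> 0 \<and> ?M *v v = z *s v}"
      by (rule finite_eigenvalues) (rule bound)
    ultimately show "finite {cmod z | z. \<exists>v. v \<noteq> 0 \<and> ?M *v v = z *s v}" by simp
    let ?u = "\<chi> i. complex_of_real (u i)"
    have "?M *v ?u = of_real \<mu> *s ?u"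
    proof -
      have "(\<Sum>j\<in>UNIV. of_nat (count_list (S j) i) * complex_of_real (u j)) = of_real \<mu> * of_real (u i)" for i
        using arg_cong[OF u(3)[of i], of complex_of_real] \<open>\<mu>' = \<mu>\<close> by simp
      then show ?thesis by (simp add: vec_eq_iff matrix_vector_mult_def subst_matrix_def)
    qed
    moreover have "?u \<noteq> 0" using ex_pos[OF u(2)] by (force simp: vec_eq_iff)
    ultimately show "\<mu> \<in> {cmod z | z. \<exists>v. v \<noteq> 0 \<and> ?M *v v = z *s v}"
      using \<open>1 \<le> \<mu>\<close> by (intro CollectI exI[of _ "complex_of_real \<mu>"]) auto
  qed (use bound in auto)
  with v_pos eig \<open>1 \<le> \<mu>\<close> show "\<exists>v. \<forall>a. 0 < v a \<and> sum_list (map v (S a)) = pf_eigenvalue S * v a"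
    and "1 \<le> pf_eigenvalue S"
    by auto
qed

section \<open>Substitutions on configurations\<close>

lemma subst_word_sublist: "sublist u w \<Longrightarrow> sublist (subst_word S u) (subst_word S w)"
  unfolding sublist_def by (metis subst_word_simps(3))

lemma subst_word_pow_sublist:
  "sublist u w \<Longrightarrow> sublist ((subst_word S ^^ n) u) ((subst_word S ^^ n) w)"
  by (induction n) (auto intro: subst_word_sublist)

section \<open>Configurations that repeat a word\<close>

text \<open>The property \<open>periodic_conf\<close> with its period word named, so that this word
  can be followed through the substitution.\<close>

definition repeats :: "'a list \<Rightarrow> 'a config \<Rightarrow> bool" where
  "repeats u \<omega> \<longleftrightarrow> u \<noteq> [] \<and> (\<forall>n. \<omega> n = u ! nat (n mod int (length u)))"

text \<open>Replaces remainders by invariance under translation by the period, the form that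
  substitution preserves visibly.\<close>

lemma repeats_iff:
  "repeats u \<omega> \<longleftrightarrow> u \<noteq> [] \<and> word_at \<omega> 0 (length u) = u \<and> (\<forall>n. \<omega> (n + int (length u)) = \<omega> n)"
proof (intro iffI; (elim conjE)?)
  assume "repeats u \<omega>"
  then show "u \<noteq> [] \<and> word_at \<omega> 0 (length u) = u \<and> (\<forall>n. \<omega> (n + int (length u)) = \<omega> n)"
    by (auto simp: repeats_def word_at_eq_iff)
next
  assume u: "u \<noteq> []" and w: "word_at \<omega> 0 (length u) = u" and per: "\<forall>n. \<omega> (n + int (length u)) = \<omega> n"
  have up: "\<omega> (n + int (length u) * int j) = \<omega> n" for n j
  proof (induction j)
    case (Suc j)
    then show ?case using per[rule_format, of "n + int (length u) * int j"] by (simp add: algebra_simps)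
  qed simp
  have all: "\<omega> (n + int (length u) * k) = \<omega> n" for n k
  proof (cases "k \<ge> 0")
    case True
    then show ?thesis using up[of n "nat k"] by simp
  next
    case False
    then show ?thesis using up[of "n + int (length u) * k" "nat (- k)"] by simp
  qed
  have "\<omega> n = u ! nat (n mod int (length u))" for n
  proof -
    have r: "0 \<le> n mod int (length u)" "n mod int (length u) < int (length u)" using u by auto
    have "\<omega> n = \<omega> (n mod int (length u) + int (length u) * (n div int (length u)))"
      by simp
    also have "\<dots> = \<omega> (n mod int (length u))" by (rule all)
    also have "\<dots> = u ! nat (n mod int (length u))"
      using r nth_word_at[of "nat (n mod int (length u))" "length u" \<omega> 0] unfolding w by simp
    finally show ?thesis .
  qed
  with u show "repeats u \<omega>" by (simp add: repeats_def)
qed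

text \<open>A word of given length is determined by its starting position modulo the period.\<close>

lemma card_words_repeats:
  assumes "repeats u \<omega>"
  shows "card {w \<in> conf_subwords \<omega>. length w = k} \<le> length u"
    and "finite {w \<in> conf_subwords \<omega>. length w = k}"
proof -
  have u: "u \<noteq> []" and per: "\<And>n. \<omega> n = u ! nat (n mod int (length u))"
    using assms by (auto simp: repeats_def)
  have sub: "{w \<in> conf_subwords \<omega>. length w = k} \<subseteq> (\<lambda>j. word_at \<omega> (int j) k) ` {..<length u}"
  proof safe
    fix w assume "w \<in> conf_subwords \<omega>" "k = length w"
    then obtain m where m: "w = word_at \<omega> m (length w)" by (metis conf_subwordsE)
    have "word_at \<omega> m (length w) = word_at \<omega> (m mod int (length u)) (length w)"
      by (simp add: word_at_eq_iff per mod_add_left_eq)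
    moreover have "nat (m mod int (length u)) < length u" "int (nat (m mod int (length u))) = m mod int (length u)"
      using u by (simp_all add: nat_less_iff)
    ultimately show "w \<in> (\<lambda>j. word_at \<omega> (int j) (length w)) ` {..<length u}"
      using m by (metis imageI lessThan_iff)
  qed
  show "finite {w \<in> conf_subwords \<omega>. length w = k}"
    using sub by (rule finite_subset) simp
  have "card {w \<in> conf_subwords \<omega>. length w = k} \<le> card ((\<lambda>j. word_at \<omega> (int j) k) ` {..<length u})"
    using sub by (intro card_mono) auto
  also have "\<dots> \<le> length u" using card_image_le[of "{..<length u}"] by simp
  finally show "card {w \<in> conf_subwords \<omega>. length w = k} \<le> length u" .
qed

section \<open>Block structure of substituted configurations\<close>

context
  fixes S :: "'a \<Rightarrow> 'a list"
  assumes ne: "\<forall>a. S a \<noteq> []"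
begin

lemma block_pos_0 [simp]: "block_pos S \<omega> 0 = 0"
  by (simp add: block_pos_def)

text \<open>One recursion for both signs; together with the value at 0 it replaces the two-branch
  definition from here on.\<close>

lemma block_pos_Suc: "block_pos S \<omega> (k + 1) = block_pos S \<omega> k + int (length (S (\<omega> k)))"
proof -
  consider "k \<ge> 0" | "k = -1" | "k < -1" by linarith
  then show ?thesis
  proof cases
    case 1
    then have "{0..<k + 1} = insert k {0..<k}" by auto
    with 1 show ?thesis by (simp add: block_pos_def)
  next
    case 2
    then have "{k..<0} = {k}" by auto
    with 2 show ?thesis by (simp add: block_pos_def)
  next
    case 3
    then have "{k..<0} = insert k {k + 1..<0}" by auto
    with 3 show ?thesis by (simp add: block_pos_def)
  qed
qed

lemma block_pos_less_Suc: "block_pos S \<omega> k < block_pos S \<omega> (k + 1)"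
  using ne[rule_format, of "\<omega> k"] by (simp add: block_pos_Suc)

lemma block_pos_growth: "block_pos S \<omega> k + int j \<le> block_pos S \<omega> (k + int j)"
proof (induction j)
  case (Suc j)
  then show ?case using block_pos_less_Suc[of \<omega> "k + int j"] by (simp add: ac_simps)
qed simp

lemma block_pos_mono: "k \<le> l \<Longrightarrow> block_pos S \<omega> k \<le> block_pos S \<omega> l"
  using block_pos_growth[of \<omega> k "nat (l - k)"] by simp

lemma ex_block: "\<exists>k. block_pos S \<omega> k \<le> n \<and> n < block_pos S \<omega> (k + 1)"
proof -
  \<comment> \<open>Blocks have length at least 1, so the block with index \<open>a\<close> starts
    at or before \<open>- \<bar>n\<bar>\<close>. The first block from there on that starts beyond
    \<open>n\<close> has the desired block as predecessor.\<close>
  define a where "a = - int (nat \<bar>n\<bar>)"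
  have a: "block_pos S \<omega> a \<le> n"
    using block_pos_growth[of \<omega> a "nat \<bar>n\<bar>"] by (simp add: a_def)
  have "\<exists>j. n < block_pos S \<omega> (a + int j)"
    using block_pos_growth[of \<omega> a "nat (n - block_pos S \<omega> a + 1)"] a
    by (intro exI[of _ "nat (n - block_pos S \<omega> a + 1)"]) auto
  then obtain j where j: "n < block_pos S \<omega> (a + int j)" "\<And>i. i < j \<Longrightarrow> \<not> n < block_pos S \<omega> (a + int i)"
    using exists_least_iff[of "\<lambda>j. n < block_pos S \<omega> (a + int j)"] by blast
  then obtain i where "j = Suc i" using a by (cases j) auto
  with j show ?thesis by (intro exI[of _ "a + int i"]) (auto simp: ac_simps not_less)
qed

lemma block_unique:
  assumes "block_pos S \<omega> k \<le> n" "n < block_pos S \<omega> (k + 1)"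
    and "block_pos S \<omega> l \<le> n" "n < block_pos S \<omega> (l + 1)"
  shows "k = l"
proof (rule ccontr)
  assume "k \<noteq> l"
  then have "k + 1 \<le> l \<or> l + 1 \<le> k" by linarith
  with assms block_pos_mono[of "k + 1" l \<omega>] block_pos_mono[of "l + 1" k \<omega>] show False by auto
qed

lemma subst_conf_block:
  assumes "i < length (S (\<omega> k))"
  shows "subst_conf S \<omega> (block_pos S \<omega> k + int i) = S (\<omega> k) ! i"
proof -
  have k: "block_pos S \<omega> k \<le> block_pos S \<omega> k + int i \<and> block_pos S \<omega> k + int i < block_pos S \<omega> (k + 1)"
    using assms by (simp add: block_pos_Suc)
  have "(THE l. block_pos S \<omega> l \<le> block_pos S \<omega> k + int i \<and> block_pos S \<omega> k + int i < block_pos S \<omega> (l + 1)) = k"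
    by (rule the_equality) (use k block_unique in blast)+
  then show ?thesis by (simp add: subst_conf_def)
qed

text \<open>Both conjuncts go through one induction: the next block is appended at the position that
  the second one computes.\<close>

lemma word_at_subst_conf:
  "word_at (subst_conf S \<omega>) (block_pos S \<omega> k) (length (subst_word S (word_at \<omega> k l)))
     = subst_word S (word_at \<omega> k l)
   \<and> block_pos S \<omega> (k + int l) = block_pos S \<omega> k + int (length (subst_word S (word_at \<omega> k l)))"
proof (induction l)
  case (Suc l)
  have w: "word_at \<omega> k (Suc l) = word_at \<omega> k l @ [\<omega> (k + int l)]"
    using word_at_add[of \<omega> k l 1] by (simp add: word_at_def)
  have "word_at (subst_conf S \<omega>) (block_pos S \<omega> (k + int l)) (length (S (\<omega> (k + int l)))) = S (\<omega> (k + int l))"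
    by (simp add: word_at_eq_iff subst_conf_block)
  moreover have "block_pos S \<omega> (k + int (Suc l)) = block_pos S \<omega> (k + int l) + int (length (S (\<omega> (k + int l))))"
    using block_pos_Suc[of \<omega> "k + int l"] by (simp add: ac_simps)
  ultimately show ?case using Suc unfolding w by (simp add: word_at_add)
qed simp

lemma subst_word_in_conf_subwords:
  assumes "w \<in> conf_subwords \<omega>"
  shows "subst_word S w \<in> conf_subwords (subst_conf S \<omega>)"
proof -
  obtain m where "w = word_at \<omega> m (length w)" using assms by (rule conf_subwordsE)
  then show ?thesis
    using word_at_subst_conf[of \<omega> m "length w"] word_at_in_conf_subwords by metis
qed

lemma conf_subwords_subst_conf:
  assumes "w \<in> conf_subwords (subst_conf S \<omega>)"
  obtains v where "v \<in> conf_subwords \<omega>" "sublist w (subst_word S v)"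
proof -
  obtain m where m: "w = word_at (subst_conf S \<omega>) m (length w)" using assms by (rule conf_subwordsE)
  obtain k where k: "block_pos S \<omega> k \<le> m" using ex_block by blast
  \<comment> \<open>As many blocks as there are positions to cover; each has length at least 1, so
    they reach the end of \<open>w\<close>.\<close>
  define l where "l = nat (m + int (length w) - block_pos S \<omega> k)"
  have "m + int (length w) \<le> block_pos S \<omega> k + int (length (subst_word S (word_at \<omega> k l)))"
    using block_pos_growth[of \<omega> k l] word_at_subst_conf[of \<omega> k l] k by (simp add: l_def)
  then have "sublist w (word_at (subst_conf S \<omega>) (block_pos S \<omega> k) (length (subst_word S (word_at \<omega> k l))))"
    by (subst m, intro word_at_sublist_word_at k)
  then have "sublist w (subst_word S (word_at \<omega> k l))" using word_at_subst_conf by metis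
  then show thesis using that word_at_in_conf_subwords by blast
qed

lemma subst_word_pow_in_conf_subwords:
  "w \<in> conf_subwords \<omega> \<Longrightarrow> (subst_word S ^^ n) w \<in> conf_subwords ((subst_conf S ^^ n) \<omega>)"
  by (induction n) (auto intro: subst_word_in_conf_subwords)

lemma conf_subwords_subst_conf_pow:
  assumes "w \<in> conf_subwords ((subst_conf S ^^ n) \<omega>)"
  obtains v where "v \<in> conf_subwords \<omega>" "sublist w ((subst_word S ^^ n) v)"
  using assms
proof (induction n arbitrary: thesis w)
  case (Suc n)
  then obtain u where u: "u \<in> conf_subwords ((subst_conf S ^^ n) \<omega>)" "sublist w (subst_word S u)"
    by (auto elim: conf_subwords_subst_conf)
  then obtain v where "v \<in> conf_subwords \<omega>" "sublist u ((subst_word S ^^ n) v)"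
    using Suc.IH by blast
  then show ?case using u(2) subst_word_sublist Suc.prems(1) sublist_order.order_trans by fastforce
qed auto

lemma repeats_subst_conf:
  assumes "repeats u \<omega>"
  shows "repeats (subst_word S u) (subst_conf S \<omega>)"
proof -
  from assms have u: "u \<noteq> []" "word_at \<omega> 0 (length u) = u" and per: "\<And>n. \<omega> (n + int (length u)) = \<omega> n"
    by (auto simp: repeats_iff)
  let ?P = "int (length (subst_word S u))"
  have bp: "block_pos S \<omega> (k + int (length u)) = block_pos S \<omega> k + ?P" for k
  proof -
    \<comment> \<open>The blocks \<open>k\<close> and \<open>k + length u\<close> have equal length
      by periodicity, so the increment over a full period does not depend on
      \<open>k\<close>.\<close>
    have step: "block_pos S \<omega> (k + 1 + int (length u)) - block_pos S \<omega> (k + 1)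
        = block_pos S \<omega> (k + int (length u)) - block_pos S \<omega> k" for k
      using block_pos_Suc[of \<omega> k] block_pos_Suc[of \<omega> "k + int (length u)"] per[of k]
      by (simp add: algebra_simps)
    have 0: "block_pos S \<omega> (0 + int (length u)) - block_pos S \<omega> 0 = ?P"
      using word_at_subst_conf[of \<omega> 0 "length u"] u by simp
    have "block_pos S \<omega> (k + int (length u)) - block_pos S \<omega> k = ?P"
    proof (induction k rule: int_induct[of _ 0])
      case base then show ?case by (rule 0)
    next
      case (step1 i) then show ?case using step[of i] by simp
    next
      case (step2 i) then show ?case using step[of "i - 1"] by simp
    qed
    then show ?thesis by simp
  qed
  have "subst_conf S \<omega> (n + ?P) = subst_conf S \<omega> n" for n
  proof -
    obtain k where k: "block_pos S \<omega> k \<le> n" "n < block_pos S \<omega> (k + 1)" using ex_block by blast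
    define i where "i = nat (n - block_pos S \<omega> k)"
    have i: "n = block_pos S \<omega> k + int i" "i < length (S (\<omega> k))"
      using k by (auto simp: i_def block_pos_Suc)
    have "subst_conf S \<omega> (block_pos S \<omega> (k + int (length u)) + int i) = S (\<omega> k) ! i"
      using subst_conf_block[of i \<omega> "k + int (length u)"] i per by simp
    then show ?thesis using subst_conf_block[of i \<omega> k] i(2) by (simp add: bp i(1) algebra_simps)
  qed
  moreover have "word_at (subst_conf S \<omega>) 0 (length (subst_word S u)) = subst_word S u"
    using word_at_subst_conf[of \<omega> 0 "length u"] u by simp
  moreover have "subst_word S u \<noteq> []" using u(1) ne by (cases u) auto
  ultimately show ?thesis by (simp add: repeats_iff)
qed

lemma repeats_subst_conf_pow:
  "repeats u \<omega> \<Longrightarrow> repeats ((subst_word S ^^ n) u) ((subst_conf S ^^ n) \<omega>)"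
  by (induction n) (auto intro: repeats_subst_conf)

end

section \<open>Languages and illegal pairs\<close>

text \<open>Repeated extension by one letter on each side gives nested words \<open>W i\<close>
  around \<open>w\<close>, whose union is a configuration.\<close>

lemma ex_config_through_word:
  assumes sub: "\<And>v w. v \<in> L \<Longrightarrow> sublist w v \<Longrightarrow> w \<in> L"
    and ext: "\<And>w. w \<in> L \<Longrightarrow> \<exists>a b. a # w @ [b] \<in> L" and w: "w \<in> L"
  shows "\<exists>\<omega>\<in>lang_shift L. w \<in> conf_subwords \<omega>"
proof -
  obtain f g where fg: "\<And>w. w \<in> L \<Longrightarrow> f w # w @ [g w] \<in> L" using ext by metis
  define W where "W i = ((\<lambda>w. f w # w @ [g w]) ^^ i) w" for i
  have W_Suc: "W (Suc i) = f (W i) # W i @ [g (W i)]" and W_0: "W 0 = w" for i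
    by (simp_all add: W_def)
  have W_L: "W i \<in> L" for i by (induction i) (auto simp: W_Suc W_0 w fg)
  have len: "length (W i) = length w + 2 * i" for i by (induction i) (auto simp: W_Suc W_0)
  have W_add: "W (i + d) ! (j + d) = W i ! j" if "j < length (W i)" for i j d
    using that by (induction d) (auto simp: W_Suc nth_append len)
  define \<omega> where "\<omega> n = W (nat \<bar>n\<bar> + 1) ! nat (n + \<bar>n\<bar> + 1)" for n :: int
  have \<omega>: "\<omega> (int j - int i) = W i ! j" if j: "j < length (W i)" for i j
  proof -
    let ?n = "int j - int i"
    define k where "k = nat \<bar>?n\<bar> + 1"
    define l where "l = nat (?n + \<bar>?n\<bar> + 1)"
    have l: "int l = ?n + int k" "l < length (W k)" by (auto simp: l_def k_def len)
    have "W k ! l = W i ! j"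
    proof (cases "k \<le> i")
      case True
      then have "W i ! j = W (k + (i - k)) ! (l + (i - k))"
        using l(1) by (intro arg_cong2[of _ _ _ _ "(!)"]) auto
      then show ?thesis using W_add[OF l(2)] by simp
    next
      case False
      then have "W k ! l = W (i + (k - i)) ! (j + (k - i))"
        using l(1) by (intro arg_cong2[of _ _ _ _ "(!)"]) auto
      then show ?thesis using W_add[OF j] by simp
    qed
    then show ?thesis by (simp add: \<omega>_def k_def l_def)
  qed
  have window: "word_at \<omega> (- int i) (length (W i)) = W i" for i
    using \<omega> by (simp add: word_at_eq_iff)
  have "conf_subwords \<omega> \<subseteq> L"
  proof (rule conf_subwords_subset_if_all_windows)
    fix r
    have "sublist (word_at \<omega> (1 - int r) (2 * r - 1)) (word_at \<omega> (- int (Suc r)) (length (W (Suc r))))"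
      by (rule word_at_sublist_word_at) (auto simp: len)
    then show "word_at \<omega> (1 - int r) (2 * r - 1) \<in> L"
      unfolding window using sub W_L by blast
  qed (rule sub)
  moreover have "w \<in> conf_subwords \<omega>"
    using window[of 0] word_at_in_conf_subwords[of \<omega> 0 "length w"] by (simp add: W_0)
  ultimately show ?thesis by (auto simp: lang_shift_def)
qed

text \<open>If there are no more words of length \<open>k + 1\<close> than of length
  \<open>k\<close>, every word of length \<open>k\<close> has only one extension to either side. A
  configuration is then determined by its word of length \<open>k\<close> at 0, which leaves
  finitely many.\<close>

lemma morse_hedlund:
  fixes L :: "'a::finite list set"
  assumes Nil: "[] \<in> L"
    and sub: "\<And>v w. v \<in> L \<Longrightarrow> sublist w v \<Longrightarrow> w \<in> L"
    and ext: "\<And>w. w \<in> L \<Longrightarrow> \<exists>a b. a # w @ [b] \<in> L"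
    and inf: "infinite (lang_shift L)"
  shows "k < card {w \<in> L. length w = k}"
proof (induction k)
  case 0
  have "{w \<in> L. length w = 0} = {[]}" using Nil by auto
  then show ?case by simp
next
  case (Suc k)
  define A where "A k = {w \<in> L. length w = k}" for k
  have fin: "finite (A k)" for k
    unfolding A_def by (rule finite_subset[OF _ finite_lists_length_eq[of UNIV k]]) auto
  have butlast_img: "butlast ` A (Suc k) = A k"
  proof safe
    fix w assume w: "w \<in> A (Suc k)"
    then have "sublist (butlast w) w" by (auto intro!: prefix_imp_sublist prefixeq_butlast)
    with w sub show "butlast w \<in> A k" by (auto simp: A_def)
  next
    fix w assume w: "w \<in> A k"
    then obtain a b where "a # w @ [b] \<in> L" using ext[of w] by (auto simp: A_def)
    then have "w @ [b] \<in> L" by (rule sub) (simp add: sublist_Cons_right)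
    then show "w \<in> butlast ` A (Suc k)" using w by (intro image_eqI[of _ _ "w @ [b]"]) (auto simp: A_def)
  qed
  have tl_img: "tl ` A (Suc k) = A k"
  proof safe
    fix w assume w: "w \<in> A (Suc k)"
    then have "sublist (tl w) w" by (auto intro!: suffix_imp_sublist suffix_tl)
    with w sub show "tl w \<in> A k" by (auto simp: A_def)
  next
    fix w assume w: "w \<in> A k"
    then obtain a b where "a # w @ [b] \<in> L" using ext[of w] by (auto simp: A_def)
    then have "a # w \<in> L" by (rule sub) (intro prefix_imp_sublist, simp)
    then show "w \<in> tl ` A (Suc k)" using w by (intro image_eqI[of _ _ "a # w"]) (auto simp: A_def)
  qed
  have "card (A k) \<le> card (A (Suc k))" using card_image_le[OF fin, of butlast "Suc k"] butlast_img by simp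
  moreover have "card (A k) \<noteq> card (A (Suc k))"
  proof
    assume eq: "card (A k) = card (A (Suc k))"
    \<comment> \<open>Surjections between finite sets of equal size are injective.\<close>
    have inj: "inj_on butlast (A (Suc k))" "inj_on tl (A (Suc k))"
      using eq butlast_img tl_img by (auto intro!: eq_card_imp_inj_on fin)
    have "inj_on (\<lambda>\<omega>. word_at \<omega> 0 k) (lang_shift L)"
    proof (rule inj_onI)
      fix x y assume xy: "x \<in> lang_shift L" "y \<in> lang_shift L" and 0: "word_at x 0 k = word_at y 0 k"
      have mem: "word_at z m (Suc k) \<in> A (Suc k)" if "z \<in> lang_shift L" for z m
        using that by (auto simp: A_def lang_shift_def)
      have bl: "butlast (word_at z m (Suc k)) = word_at z m k" for z :: "'a config" and m
        by (simp add: list_eq_iff_nth_eq nth_butlast)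
      have tl: "tl (word_at z m (Suc k)) = word_at z (m + 1) k" for z :: "'a config" and m
        by (simp add: list_eq_iff_nth_eq nth_tl algebra_simps)
      have up: "word_at x m (Suc k) = word_at y m (Suc k)" if "word_at x m k = word_at y m k" for m
        using inj_onD[OF inj(1) _ mem mem] xy bl that by metis
      have down: "word_at x m (Suc k) = word_at y m (Suc k)" if "word_at x (m + 1) k = word_at y (m + 1) k" for m
        using inj_onD[OF inj(2) _ mem mem] xy tl that by metis
      have all: "word_at x m k = word_at y m k" for m
      proof (induction m rule: int_induct[of _ 0])
        case base show ?case by (rule 0)
      next
        case (step1 i) then show ?case using up[of i] tl by metis
      next
        case (step2 i) then show ?case using down[of "i - 1"] bl by (metis diff_add_cancel)
      qed
      show "x = y"
      proof
        fix m
        have "word_at x m (Suc k) ! 0 = word_at y m (Suc k) ! 0" using up all by metis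
        then show "x m = y m" by simp
      qed
    qed
    moreover have "(\<lambda>\<omega>. word_at \<omega> 0 k) ` lang_shift L \<subseteq> A k" by (auto simp: A_def lang_shift_def)
    ultimately have "finite (lang_shift L)" using fin finite_imageD finite_subset by metis
    with inf show False by blast
  qed
  ultimately show ?case using Suc by (simp add: A_def)
qed

section \<open>Short words inside images of pairs, and paths of illegal pairs\<close>

text \<open>A power of \<open>S\<close> is itself a substitution, so facts about one step of an
  arbitrary \<open>T\<close> apply to it.\<close>

lemma subst_word_pow_eq:
  "(subst_word S ^^ n) w = subst_word (\<lambda>a. (subst_word S ^^ n) [a]) w"
proof (induction w)
  case (Cons a w)
  then show ?case by (subst subst_word_pow_Cons) simp
qed simp

text \<open>Meeting three consecutive blocks takes a whole middle block and at least two further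
  letters, more than \<open>w\<close> has. So \<open>w\<close> meets at most two blocks, and a
  single block is completed to a pair since \<open>v\<close> has two letters.\<close>

lemma sublist_subst_word_pair:
  assumes "sublist w (subst_word T v)" "2 \<le> length v" "\<And>a. length w \<le> Suc (length (T a))"
  obtains a b where "sublist [a, b] v" "sublist w (subst_word T [a, b])"
proof -
  have "\<exists>a b. sublist [a, b] v \<and> sublist w (subst_word T [a, b])"
    using assms(1,2)
  proof (induction v)
    case (Cons a v)
    note IH = Cons.IH
    from Cons obtain b v' where v: "v = b # v'" by (cases v) auto
    have ab: "sublist [a, b] (a # v)" by (intro prefix_imp_sublist) (simp add: v)
    have "sublist w (T a @ subst_word T v)" using Cons.prems(1) by simp
    then consider "sublist w (T a)" | "sublist w (subst_word T v)"
      | w1 w2 where "w = w1 @ w2" "suffix w1 (T a)" "prefix w2 (subst_word T v)" "w1 \<noteq> []"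
      unfolding sublist_append by (metis append_Nil prefix_imp_sublist)
    then show ?case
    proof cases
      case 1
      then have "sublist w (subst_word T [a, b])" by (simp add: sublist_append)
      with ab show ?thesis by blast
    next
      case 2
      show ?thesis
      proof (cases v')
        case Nil
        with 2 v have "sublist w (subst_word T [a, b])" by (simp add: sublist_append)
        with ab show ?thesis by blast
      next
        case (Cons c v'')
        then obtain a' b' where "sublist [a', b'] v" "sublist w (subst_word T [a', b'])"
          using IH[OF 2] v by auto
        then show ?thesis using sublist_Cons_right by metis
      qed
    next
      case (3 w1 w2)
      have "length w2 \<le> length (T b)" using assms(3)[of b] 3(1,4) by (cases w1) auto
      then have "prefix w2 (T b)" using 3(3) unfolding v
        by (auto simp: prefix_append)
      then have "sublist w (subst_word T [a, b])" using 3 by (auto simp: sublist_append)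
      with ab show ?thesis by blast
    qed
  qed simp
  with that show thesis by blast
qed

lemma legal_words_sublist: "v \<in> legal_words S \<Longrightarrow> sublist w v \<Longrightarrow> w \<in> legal_words S"
  unfolding legal_words_def using sublist_order.order_trans by blast

lemma subst_word_pow_letter_legal: "(subst_word S ^^ n) [a] \<in> legal_words S"
  by (auto simp: legal_words_def)

lemma Nil_legal: "[] \<in> legal_words S"
  by (auto simp: legal_words_def)

lemma subst_word_pow_legal:
  assumes "w \<in> legal_words S"
  shows "(subst_word S ^^ n) w \<in> legal_words S"
proof -
  obtain a k where "sublist w ((subst_word S ^^ k) [a])" using assms by (auto simp: legal_words_def)
  then have "sublist ((subst_word S ^^ n) w) ((subst_word S ^^ (n + k)) [a])"
    using subst_word_pow_sublist by (simp add: funpow_add)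
  then show ?thesis by (auto simp: legal_words_def)
qed

context
  fixes S :: "'a \<Rightarrow> 'a list"
  assumes ne: "\<forall>a. S a \<noteq> []"
begin

lemma length_subst_word_ge: "length w \<le> length (subst_word S w)"
proof (induction w)
  case (Cons a w)
  then show ?case using ne[rule_format, of a] by (cases "S a") auto
qed simp

lemma length_subst_word_pow_ge: "length w \<le> length ((subst_word S ^^ n) w)"
proof (induction n)
  case (Suc n)
  then show ?case using length_subst_word_ge[of "(subst_word S ^^ n) w"] by simp
qed simp

lemma subst_word_pow_nonempty: "w \<noteq> [] \<Longrightarrow> (subst_word S ^^ n) w \<noteq> []"
  using length_subst_word_pow_ge[of w n] by auto

lemma conf_subwords_subst_conf_pow_pair:
  assumes "w \<in> conf_subwords ((subst_conf S ^^ n) \<omega>)"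
    and "\<And>a. length w \<le> Suc (length ((subst_word S ^^ n) [a]))"
  obtains u where "u \<in> conf_subwords \<omega>" "length u = 2" "sublist w ((subst_word S ^^ n) u)"
proof -
  obtain v where v: "v \<in> conf_subwords \<omega>" "sublist w ((subst_word S ^^ n) v)"
    using assms(1) by (rule conf_subwords_subst_conf_pow[OF ne])
  obtain m where m: "v = word_at \<omega> m (length v)" using v(1) by (rule conf_subwordsE)
  \<comment> \<open>The word \<open>v\<close> may have fewer than two letters; the extension
    guarantees a pair.\<close>
  define v' where "v' = word_at \<omega> m (length v + 2)"
  have "sublist v v'" unfolding v'_def by (subst m, rule word_at_sublist_word_at) auto
  then have "sublist w ((subst_word S ^^ n) v')"
    using v(2) subst_word_pow_sublist sublist_order.order_trans by blast
  then have "sublist w (subst_word (\<lambda>a. (subst_word S ^^ n) [a]) v')"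
    by (simp only: subst_word_pow_eq[symmetric])
  then obtain a b where ab: "sublist [a, b] v'" "sublist w (subst_word (\<lambda>a. (subst_word S ^^ n) [a]) [a, b])"
    by (rule sublist_subst_word_pair) (auto simp: v'_def assms(2))
  have "[a, b] \<in> conf_subwords \<omega>"
    using ab(1) conf_subwords_sublist word_at_in_conf_subwords unfolding v'_def by blast
  then show thesis using ab(2) by (intro that[of "[a, b]"]) (simp_all only: subst_word_pow_eq[symmetric], simp)
qed

text \<open>Images of legal words are legal, so the pair from which an illegal pair arises is
  illegal too; tracing back through all \<open>n\<close> steps gives a path in the graph.\<close>

lemma illegal_pair_path:
  assumes "w \<in> conf_subwords ((subst_conf S ^^ n) \<omega>)" "length w = 2" "w \<notin> legal_words S"
  shows "\<exists>vs. length vs = Suc n \<and> hd vs \<in> conf_subwords \<omega> \<and> (\<forall>v\<in>set vs. length v = 2)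
    \<and> (\<forall>i. Suc i < length vs \<longrightarrow> G_edge S (vs ! i) (vs ! Suc i)) \<and> last vs = w"
  using assms
proof (induction n arbitrary: w)
  case 0
  then show ?case by (intro exI[of _ "[w]"]) auto
next
  case (Suc n)
  have "w \<in> conf_subwords ((subst_conf S ^^ 1) ((subst_conf S ^^ n) \<omega>))" using Suc.prems(1) by simp
  then obtain u where u: "u \<in> conf_subwords ((subst_conf S ^^ n) \<omega>)" "length u = 2"
      "sublist w ((subst_word S ^^ 1) u)"
  proof (rule conf_subwords_subst_conf_pow_pair)
    show "length w \<le> Suc (length ((subst_word S ^^ 1) [a]))" for a
      using Suc.prems(2) length_subst_word_pow_ge[of "[a]" 1] by simp
  qed
  have "u \<notin> legal_words S"
    using subst_word_pow_legal[of u S 1] legal_words_sublist u(3) Suc.prems(3) by blast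
  with u Suc.prems have edge: "G_edge S u w" by (auto simp: G_edge_def)
  obtain vs where vs: "length vs = Suc n" "hd vs \<in> conf_subwords \<omega>" "\<forall>v\<in>set vs. length v = 2"
     "\<forall>i. Suc i < length vs \<longrightarrow> G_edge S (vs ! i) (vs ! Suc i)" "last vs = u"
    using Suc.IH[OF u(1,2) \<open>u \<notin> legal_words S\<close>] by blast
  have "G_edge S ((vs @ [w]) ! i) ((vs @ [w]) ! Suc i)" if "Suc i < length (vs @ [w])" for i
  proof (cases "Suc i < length vs")
    case True
    then show ?thesis using vs(4) by (simp add: nth_append)
  next
    case False
    then have "i = n" using that vs(1) by simp
    moreover have "vs ! n = u" using vs(1,5) by (metis diff_Suc_1 last_conv_nth list.size(3) nat.distinct(1))
    ultimately show ?thesis using edge vs(1) by (simp add: nth_append)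
  qed
  moreover have "hd (vs @ [w]) = hd vs" using vs(1) by (cases vs) auto
  ultimately show ?case using vs Suc.prems(2) by (intro exI[of _ "vs @ [w]"]) auto
qed

end

text \<open>An illegal pair after \<open>n\<close> steps ends a path with \<open>n + 1\<close>
  vertices. Goodness makes them distinct, but there are at most \<open>n\<close> pairs of
  letters.\<close>

lemma good_approximant_pairs_legal:
  fixes S :: "'a::finite \<Rightarrow> 'a list"
  assumes ne: "\<forall>a. S a \<noteq> []" and good: "good_approximant S \<omega>" and n: "CARD('a)\<^sup>2 \<le> n"
    and w: "w \<in> conf_subwords ((subst_conf S ^^ n) \<omega>)" "length w = 2"
  shows "w \<in> legal_words S"
proof (rule ccontr)
  assume "w \<notin> legal_words S"
  then obtain vs where vs: "length vs = Suc n" "hd vs \<in> conf_subwords \<omega>" "\<forall>v\<in>set vs. length v = 2"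
     "\<forall>i. Suc i < length vs \<longrightarrow> G_edge S (vs ! i) (vs ! Suc i)"
    using illegal_pair_path[OF ne w] by blast
  have "vs \<noteq> []" using vs(1) by auto
  with vs good have "distinct vs" unfolding good_approximant_def by (metis hd_in_set)
  then have "Suc n = card (set vs)" using vs(1) by (simp add: distinct_card)
  also have "\<dots> \<le> card {xs :: 'a list. set xs \<subseteq> UNIV \<and> length xs = 2}"
    using vs(3) by (intro card_mono finite_lists_length_eq) auto
  also have "\<dots> = CARD('a)\<^sup>2" by (rule card_lists_length_eq) simp
  finally show False using n by simp
qed

section \<open>The subshift of a primitive substitution\<close>

context
  fixes S :: "'a \<Rightarrow> 'a list"
  assumes ne: "\<forall>a. S a \<noteq> []" and prim: "primitive S"
begin

text \<open>Apply the \<open>p\<close>-th power to the nonempty word \<open>S^k(a)\<close>: the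
  image of its first letter already contains all letters.\<close>

lemma primitive_eventually:
  "\<exists>p. \<forall>n\<ge>p. \<forall>a b. b \<in> set ((subst_word S ^^ n) [a])"
proof -
  from prim obtain p where p: "\<And>a b. b \<in> set ((subst_word S ^^ p) [a])"
    unfolding primitive_def by blast
  have "b \<in> set ((subst_word S ^^ (p + k)) [a])" for k a b
  proof -
    have "(subst_word S ^^ k) [a] \<noteq> []" by (rule subst_word_pow_nonempty[OF ne]) simp
    then obtain c w where "(subst_word S ^^ k) [a] = c # w" by (cases "(subst_word S ^^ k) [a]") auto
    then have "(subst_word S ^^ (p + k)) [a] = (subst_word S ^^ p) [c] @ (subst_word S ^^ p) w"
      by (simp add: funpow_add subst_word_pow_Cons[of p S c w])
    with p[of b c] show ?thesis by simp
  qed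
  then show ?thesis by (metis le_Suc_ex)
qed

text \<open>Splits off the identity on one letter, whose legal words cannot be extended. With two
  letters in the alphabet, a power of \<open>S\<close> places both of them in the image of every
  letter.\<close>

lemma primitive_growing_or_trivial:
  "(\<exists>q. \<forall>a. 2 \<le> length ((subst_word S ^^ q) [a])) \<or> (\<forall>a b::'a. a = b) \<and> (\<forall>a. S a = [a])"
proof (cases "\<forall>a b::'a. a = b")
  case True
  show ?thesis
  proof (cases "\<exists>a. 2 \<le> length (S a)")
    case True
    then have "\<forall>a. 2 \<le> length (S a)" using \<open>\<forall>a b::'a. a = b\<close> by metis
    then have "\<forall>a. 2 \<le> length ((subst_word S ^^ 1) [a])" by simp
    then show ?thesis by blast
  next
    case False
    have "S a = [a]" for a
    proof -
      obtain b w where "S a = b # w" using ne[rule_format, of a] by (cases "S a") auto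
      moreover have "w = []" using False \<open>S a = b # w\<close> by (cases w) (auto simp: not_le dest: spec[of _ a])
      ultimately show ?thesis using True by auto
    qed
    with True show ?thesis by blast
  qed
next
  case False
  then obtain x y :: 'a where xy: "x \<noteq> y" by blast
  obtain p where p: "\<And>n a b. p \<le> n \<Longrightarrow> b \<in> set ((subst_word S ^^ n) [a])"
    using primitive_eventually by blast
  have "2 \<le> length ((subst_word S ^^ p) [a])" for a
  proof -
    have "2 = card {x, y}" using xy by simp
    also have "\<dots> \<le> card (set ((subst_word S ^^ p) [a]))" using p by (intro card_mono) auto
    also have "\<dots> \<le> length ((subst_word S ^^ p) [a])" by (rule card_length)
    finally show ?thesis .
  qed
  then show ?thesis by blast
qed

lemma letter_sublist_subst_word_pow:
  assumes "c \<in> set ((subst_word S ^^ k) [d])"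
  shows "sublist ((subst_word S ^^ n) [c]) ((subst_word S ^^ (n + k)) [d])"
proof -
  have "sublist [c] ((subst_word S ^^ k) [d])" using assms by (auto simp: in_set_conv_decomp sublist_def)
  then show ?thesis using subst_word_pow_sublist by (simp add: funpow_add)
qed

text \<open>If \<open>u\<close> lies in \<open>S^k(a)\<close>, then \<open>a\<close> occurs in
  \<open>S^(n-k)(c)\<close> as soon as \<open>n - k\<close> is large. The eventual form allows
  finitely many such conditions to be combined.\<close>

lemma eventually_legal_word_occurs:
  assumes "u \<in> legal_words S"
  shows "\<forall>\<^sub>F n in sequentially. \<forall>c. sublist u ((subst_word S ^^ n) [c])"
proof -
  obtain p where p: "\<And>n a b. p \<le> n \<Longrightarrow> b \<in> set ((subst_word S ^^ n) [a])"
    using primitive_eventually by blast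
  obtain a k where u: "sublist u ((subst_word S ^^ k) [a])" using assms by (auto simp: legal_words_def)
  have "sublist u ((subst_word S ^^ n) [c])" if "k + p \<le> n" for n c
  proof -
    have "sublist ((subst_word S ^^ k) [a]) ((subst_word S ^^ (k + (n - k))) [c])"
      using that by (intro letter_sublist_subst_word_pow p) simp
    with u that show ?thesis using sublist_order.order_trans by fastforce
  qed
  then show ?thesis by (auto simp: eventually_sequentially)
qed

section \<open>Growing substitutions: extendable language and the subshift\<close>

context
  assumes growing: "\<exists>q. \<forall>a. 2 \<le> length ((subst_word S ^^ q) [a])"
begin

lemma eventually_length_ge_2: "\<forall>\<^sub>F n in sequentially. \<forall>a. 2 \<le> length ((subst_word S ^^ n) [a])"
proof -
  obtain q where q: "\<And>a. 2 \<le> length ((subst_word S ^^ q) [a])" using growing by blast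
  have "2 \<le> length ((subst_word S ^^ n) [a])" if "q \<le> n" for n a
  proof -
    have "(subst_word S ^^ n) [a] = (subst_word S ^^ (n - q)) ((subst_word S ^^ q) [a])"
      using that funpow_add[of "n - q" q "subst_word S"] by simp
    then show ?thesis
      using length_subst_word_pow_ge[OF ne, of "(subst_word S ^^ q) [a]" "n - q"] q[of a] by simp
  qed
  then show ?thesis by (auto simp: eventually_sequentially)
qed

text \<open>The word \<open>w\<close> is found inside the image of the second letter of a word with
  at least three letters; the nonempty images of its neighbours supply \<open>a\<close> and
  \<open>b\<close>.\<close>

lemma legal_word_extends:
  assumes "w \<in> legal_words S"
  shows "\<exists>a b. a # w @ [b] \<in> legal_words S"
proof -
  obtain q where q: "\<And>a. 2 \<le> length ((subst_word S ^^ q) [a])" using growing by blast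
  obtain p where p: "\<And>n a b. p \<le> n \<Longrightarrow> b \<in> set ((subst_word S ^^ n) [a])"
    using primitive_eventually by blast
  obtain c n where w: "sublist w ((subst_word S ^^ n) [c])" using assms by (auto simp: legal_words_def)
  \<comment> \<open>Two rounds of growth: \<open>S^(2q)(c)\<close> begins with \<open>x1\<close>,
    \<open>x2\<close> and has at least one more letter, coming from \<open>y\<close>.\<close>
  obtain x y t where xy: "(subst_word S ^^ q) [c] = x # y # t"
    using q[of c] by (cases "(subst_word S ^^ q) [c]"; cases "tl ((subst_word S ^^ q) [c])") auto
  obtain x1 x2 tx where x: "(subst_word S ^^ q) [x] = x1 # x2 # tx"
    using q[of x] by (cases "(subst_word S ^^ q) [x]"; cases "tl ((subst_word S ^^ q) [x])") auto
  have "(subst_word S ^^ (q + q)) [c] = (subst_word S ^^ q) [x] @ (subst_word S ^^ q) (y # t)"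
    by (simp add: funpow_add xy subst_word_pow_Cons[of q S x "y # t"])
  then have "(subst_word S ^^ (q + q)) [c] = [x1] @ [x2] @ (tx @ (subst_word S ^^ q) (y # t))"
    by (simp add: x)
  then have decomp: "(subst_word S ^^ (k + (q + q))) [c]
      = (subst_word S ^^ k) [x1] @ (subst_word S ^^ k) [x2] @ (subst_word S ^^ k) (tx @ (subst_word S ^^ q) (y # t))" for k
    unfolding funpow_add[of k] comp_apply by (simp only: subst_word_pow_append)
  \<comment> \<open>The letter \<open>c\<close> recurs in \<open>S^p(x2)\<close>, so
    \<open>w\<close> occurs in \<open>S^(n+p)(x2)\<close>.\<close>
  obtain X Y where XY: "(subst_word S ^^ p) [x2] = X @ [c] @ Y"
    using p[of p c x2] by (auto simp: in_set_conv_decomp)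
  have "(subst_word S ^^ (n + p)) [x2] = (subst_word S ^^ n) X @ (subst_word S ^^ n) [c] @ (subst_word S ^^ n) Y"
    unfolding funpow_add comp_apply XY by (simp only: subst_word_pow_append)
  moreover obtain ps ss where "(subst_word S ^^ n) [c] = ps @ w @ ss" using w by (auto simp: sublist_def)
  ultimately have eq: "(subst_word S ^^ ((n + p) + (q + q))) [c] =
      ((subst_word S ^^ (n + p)) [x1] @ (subst_word S ^^ n) X @ ps) @ w
        @ (ss @ (subst_word S ^^ n) Y @ (subst_word S ^^ (n + p)) (tx @ (subst_word S ^^ q) (y # t)))"
    unfolding decomp by simp
  let ?A = "(subst_word S ^^ (n + p)) [x1] @ (subst_word S ^^ n) X @ ps"
  let ?B = "ss @ (subst_word S ^^ n) Y @ (subst_word S ^^ (n + p)) (tx @ (subst_word S ^^ q) (y # t))"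
  have "(subst_word S ^^ (n + p)) [x1] \<noteq> []" by (rule subst_word_pow_nonempty[OF ne]) simp
  then obtain A a where A: "?A = A @ [a]" by (metis append_is_Nil_conv rev_exhaust)
  have "(subst_word S ^^ (n + p)) (tx @ (subst_word S ^^ q) (y # t)) \<noteq> []"
    by (intro subst_word_pow_nonempty[OF ne]) (simp add: subst_word_pow_nonempty[OF ne])
  then obtain b B where B: "?B = b # B" by (metis append_is_Nil_conv list.exhaust)
  have "(subst_word S ^^ ((n + p) + (q + q))) [c] = A @ (a # w @ [b]) @ B"
    unfolding eq A B by simp
  then have "sublist (a # w @ [b]) ((subst_word S ^^ ((n + p) + (q + q))) [c])"
    by (metis sublist_appendI)
  then show ?thesis by (auto simp: legal_words_def)
qed

lemma lang_lang_shift_legal: "lang (lang_shift (legal_words S)) = legal_words S"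
proof
  show "legal_words S \<subseteq> lang (lang_shift (legal_words S))"
  proof
    fix w assume "w \<in> legal_words S"
    with legal_words_sublist legal_word_extends
    have "\<exists>\<omega>\<in>lang_shift (legal_words S). w \<in> conf_subwords \<omega>"
      by (rule ex_config_through_word)
    then show "w \<in> lang (lang_shift (legal_words S))" by (auto simp: lang_def)
  qed
qed (rule lang_lang_shift_subset)

lemma lang_shift_legal_nonempty: "lang_shift (legal_words S) \<noteq> {}"
  using lang_lang_shift_legal Nil_legal[of S] by (auto simp: lang_def)

text \<open>Existence rests on two-sided extendability of legal words, uniqueness on
  \<open>subshift_unique\<close>.\<close>

lemma subst_shift_eq: "subst_shift S = lang_shift (legal_words S)"
  unfolding subst_shift_def
proof (rule the_equality)
  show "subshift (lang_shift (legal_words S)) \<and> lang (lang_shift (legal_words S)) = legal_words S"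
    using subshift_lang_shift[OF lang_shift_legal_nonempty] legal_words_sublist lang_lang_shift_legal by blast
qed (use subshift_unique lang_lang_shift_legal in blast)

lemma legal_word_in_image_of_pair:
  assumes "w \<in> legal_words S" "\<And>a. length w \<le> Suc (length ((subst_word S ^^ m) [a]))"
  obtains u where "u \<in> legal_words S" "length u = 2" "sublist w ((subst_word S ^^ m) u)"
proof -
  \<comment> \<open>The exponent is split so that the last \<open>m\<close> steps act on
    \<open>S^n(c)\<close>, which for large \<open>n\<close> is long enough to contain a
    pair.\<close>
  have "\<forall>\<^sub>F n in sequentially. \<forall>c. sublist w ((subst_word S ^^ (n + m)) [c])"
    using eventually_legal_word_occurs[OF assms(1)] by (rule sequentially_offset)
  then have "\<forall>\<^sub>F n in sequentially. (\<forall>c. sublist w ((subst_word S ^^ (n + m)) [c]))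
      \<and> (\<forall>a. 2 \<le> length ((subst_word S ^^ n) [a]))"
    using eventually_length_ge_2 by (rule eventually_conj)
  then obtain n where n: "\<And>c. sublist w ((subst_word S ^^ (n + m)) [c])"
      "\<And>a. 2 \<le> length ((subst_word S ^^ n) [a])"
    by (auto simp: eventually_sequentially)
  define v where "v = (subst_word S ^^ n) [undefined]"
  have "sublist w ((subst_word S ^^ m) v)"
    using n(1)[of undefined] unfolding v_def add.commute[of n m] by (simp add: funpow_add)
  then have "sublist w (subst_word (\<lambda>a. (subst_word S ^^ m) [a]) v)"
    by (simp only: subst_word_pow_eq[symmetric])
  then obtain a b where ab: "sublist [a, b] v" "sublist w (subst_word (\<lambda>a. (subst_word S ^^ m) [a]) [a, b])"
    by (rule sublist_subst_word_pair) (auto simp: v_def n assms(2))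
  have "[a, b] \<in> legal_words S"
    by (rule legal_words_sublist[OF subst_word_pow_letter_legal ab(1)[unfolded v_def]])
  then show thesis using ab(2) by (intro that[of "[a, b]"]) (simp_all only: subst_word_pow_eq[symmetric], simp)
qed

end

end

lemma ex_uniform_pair_power:
  fixes S :: "'a::finite \<Rightarrow> 'a list"
  assumes "\<forall>a. S a \<noteq> []" "primitive S"
  shows "\<exists>q. \<forall>u\<in>legal_words S. length u = 2 \<longrightarrow> (\<forall>c. sublist u ((subst_word S ^^ q) [c]))"
proof -
  let ?U = "{u \<in> legal_words S. length u = 2}"
  have "finite ?U" by (rule finite_subset[OF _ finite_lists_length_eq[of UNIV 2]]) auto
  then have "\<forall>\<^sub>F n in sequentially. \<forall>u\<in>?U. \<forall>c. sublist u ((subst_word S ^^ n) [c])"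
    using eventually_legal_word_occurs[OF assms] by (intro eventually_ball_finite) auto
  then show ?thesis by (auto simp: eventually_sequentially)
qed

section \<open>Growth of the lengths of iterated words\<close>

text \<open>The weight by the positive left eigenvector scales exactly by the eigenvalue, and it
  differs from the length by factors between \<open>lo\<close> and \<open>hi\<close>.\<close>

lemma length_growth:
  fixes S :: "'a::finite \<Rightarrow> 'a list"
  assumes ne: "\<forall>a. S a \<noteq> []" and prim: "primitive S"
  shows "\<exists>c>0. \<forall>n a. c * pf_eigenvalue S ^ n \<le> real (length ((subst_word S ^^ n) [a]))"
    and "\<exists>C>0. \<forall>n w. real (length ((subst_word S ^^ n) w)) \<le> C * pf_eigenvalue S ^ n * real (length w)"
proof -
  obtain v :: "'a \<Rightarrow> real" where v: "\<And>a. 0 < v a"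
      "\<And>a. sum_list (map v (S a)) = pf_eigenvalue S * v a"
    using perron_frobenius(1)[OF ne prim] by blast
  define lo where "lo = Min (range v)"
  define hi where "hi = Max (range v)"
  have lo: "0 < lo" "\<And>a. lo \<le> v a" unfolding lo_def using v(1) by (auto simp: Min_gr_iff)
  have hi: "\<And>a. v a \<le> hi" unfolding hi_def by auto
  then have "0 < hi" using v(1) less_le_trans by blast
  have sum_lo: "lo * real (length w) \<le> sum_list (map v w)" for w
    by (induction w) (auto simp: algebra_simps intro: add_mono lo)
  have sum_hi: "sum_list (map v w) \<le> hi * real (length w)" for w
    by (induction w) (auto simp: algebra_simps intro: add_mono hi)
  let ?\<theta> = "pf_eigenvalue S"
  have pos: "0 < ?\<theta> ^ n" for n using perron_frobenius(2)[OF ne prim] by simp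
  have "lo / hi * ?\<theta> ^ n \<le> real (length ((subst_word S ^^ n) [a]))" for n a
  proof -
    have "lo * ?\<theta> ^ n \<le> v a * ?\<theta> ^ n" using lo(2) pos[of n] by (intro mult_right_mono) auto
    also have "\<dots> = sum_list (map v ((subst_word S ^^ n) [a]))"
      by (simp add: sum_list_subst_word_pow[OF v(2)])
    also have "\<dots> \<le> hi * real (length ((subst_word S ^^ n) [a]))" by (rule sum_hi)
    finally show ?thesis using \<open>0 < hi\<close> by (simp add: field_simps)
  qed
  moreover have "real (length ((subst_word S ^^ n) w)) \<le> hi / lo * ?\<theta> ^ n * real (length w)" for n w
  proof -
    have "lo * real (length ((subst_word S ^^ n) w)) \<le> sum_list (map v ((subst_word S ^^ n) w))" by (rule sum_lo)
    also have "\<dots> = ?\<theta> ^ n * sum_list (map v w)" by (rule sum_list_subst_word_pow[OF v(2)])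
    also have "\<dots> \<le> ?\<theta> ^ n * (hi * real (length w))"
      using pos[of n] sum_hi by (intro mult_left_mono) auto
    finally show ?thesis using lo(1) by (simp add: field_simps)
  qed
  moreover have "0 < lo / hi" "0 < hi / lo" using lo(1) \<open>0 < hi\<close> by simp_all
  ultimately show "\<exists>c>0. \<forall>n a. c * ?\<theta> ^ n \<le> real (length ((subst_word S ^^ n) [a]))"
    and "\<exists>C>0. \<forall>n w. real (length ((subst_word S ^^ n) w)) \<le> C * ?\<theta> ^ n * real (length w)"
    by blast+
qed

lemma lang_shift_conf_subwords_nonempty: "lang_shift (conf_subwords \<omega>) \<noteq> {}"
  by (auto simp: lang_shift_def)

section \<open>Upper bound for good approximants\<close>

lemma hausdorff_dist_upper_bound:
  fixes S :: "'a::finite \<Rightarrow> 'a list"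
  assumes ne: "\<forall>a. S a \<noteq> []" and prim: "primitive S"
    and growing: "\<exists>q. \<forall>a. 2 \<le> length ((subst_word S ^^ q) [a])"
  shows "\<exists>C>0. \<forall>\<omega>. good_approximant S \<omega> \<longrightarrow>
    (\<forall>n. hausdorff_dist (IHS S n \<omega>) (subst_shift S) \<le> C / pf_eigenvalue S ^ n)"
proof -
  let ?\<theta> = "pf_eigenvalue S"
  have \<theta>: "1 \<le> ?\<theta>" by (rule perron_frobenius(2)[OF ne prim])
  then have pos: "0 < ?\<theta> ^ n" for n by simp
  obtain q where q: "\<And>u c. u \<in> legal_words S \<Longrightarrow> length u = 2 \<Longrightarrow> sublist u ((subst_word S ^^ q) [c])"
    using ex_uniform_pair_power[OF ne prim] by blast
  obtain c where c: "0 < c" "\<And>n a. c * ?\<theta> ^ n \<le> real (length ((subst_word S ^^ n) [a]))"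
    using length_growth(1)[OF ne prim] by blast
  \<comment> \<open>\<open>CARD('a)\<^sup>2\<close> steps remove all illegal pairs and
    \<open>q\<close> further steps create all legal ones. In \<open>C\<close> the summand 1 pays for
    \<open>n < K\<close>, where the distance is merely at most 1, and \<open>2 / c\<close> for
    \<open>n \<ge> K\<close>.\<close>
  define K where "K = CARD('a)\<^sup>2 + q"
  define C where "C = ?\<theta> ^ K * (1 + 2 / c)"
  note eq = IHS_eq_lang_shift subst_shift_eq[OF ne prim growing]
  have le: "hausdorff_dist (IHS S n \<omega>) (subst_shift S) \<le> 1 / (real r + 1)"
    if "\<And>w. length w = 2 * r - 1 \<Longrightarrow> w \<in> conf_subwords ((subst_conf S ^^ n) \<omega>) \<longleftrightarrow> w \<in> legal_words S"
    for n r \<omega>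
    unfolding eq using that lang_shift_legal_nonempty[OF ne prim growing]
    by (intro hausdorff_dist_le lang_shift_conf_subwords_nonempty)
      (simp_all add: lang_lang_shift_legal[OF ne prim growing])
  have "hausdorff_dist (IHS S n \<omega>) (subst_shift S) \<le> C / ?\<theta> ^ n" if good: "good_approximant S \<omega>" for \<omega> n
  proof (cases "K \<le> n")
    case False
    have "hausdorff_dist (IHS S n \<omega>) (subst_shift S) \<le> 1 / (real 0 + 1)"
      using word_at_in_conf_subwords[of "(subst_conf S ^^ n) \<omega>" 0 0] by (intro le) (auto simp: Nil_legal)
    also have "\<dots> \<le> ?\<theta> ^ K / ?\<theta> ^ n"
      using False \<theta> pos[of n] by (simp add: power_increasing)
    also have "\<dots> \<le> C / ?\<theta> ^ n"
      using c(1) pos[of n] pos[of K] by (intro divide_right_mono) (auto simp: C_def)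
    finally show ?thesis .
  next
    case True
    define m where "m = n - K"
    have n: "n = m + (q + CARD('a)\<^sup>2)" using True by (simp add: m_def K_def)
    define l where "l = Min (range (\<lambda>a. length ((subst_word S ^^ m) [a])))"
    have l: "\<And>a. l \<le> length ((subst_word S ^^ m) [a])" by (simp add: l_def)
    have "l \<in> range (\<lambda>a. length ((subst_word S ^^ m) [a]))" unfolding l_def by (rule Min_in) auto
    then have l_ge: "c * ?\<theta> ^ m \<le> real l" using c(2) by auto
    \<comment> \<open>The radius \<open>l div 2 + 1\<close> has window length at most
      \<open>l + 1\<close>, the longest that is sure to meet only two blocks of
      \<open>S^m\<close>.\<close>
    have "hausdorff_dist (IHS S n \<omega>) (subst_shift S) \<le> 1 / (real (l div 2 + 1) + 1)"
    proof (rule le)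
      fix w :: "'a list" assume "length w = 2 * (l div 2 + 1) - 1"
      then have w: "length w \<le> Suc (length ((subst_word S ^^ m) [a]))" for a
        using l[of a] by simp
      show "w \<in> conf_subwords ((subst_conf S ^^ n) \<omega>) \<longleftrightarrow> w \<in> legal_words S"
      proof
        assume "w \<in> conf_subwords ((subst_conf S ^^ n) \<omega>)"
        then have "w \<in> conf_subwords ((subst_conf S ^^ m) ((subst_conf S ^^ (q + CARD('a)\<^sup>2)) \<omega>))"
          unfolding n by (simp add: funpow_add)
        then obtain u where u: "u \<in> conf_subwords ((subst_conf S ^^ (q + CARD('a)\<^sup>2)) \<omega>)" "length u = 2"
            "sublist w ((subst_word S ^^ m) u)"
          using w by (rule conf_subwords_subst_conf_pow_pair[OF ne])
        have "u \<in> legal_words S"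
          using good_approximant_pairs_legal[OF ne good _ u(1,2)] by simp
        then show "w \<in> legal_words S" by (rule legal_words_sublist[OF subst_word_pow_legal u(3)])
      next
        assume "w \<in> legal_words S"
        then obtain u where u: "u \<in> legal_words S" "length u = 2" "sublist w ((subst_word S ^^ m) u)"
          using w by (rule legal_word_in_image_of_pair[OF ne prim growing])
        \<comment> \<open>Whatever letter \<open>x\<close> has at 0, its image under
          \<open>S^q\<close> contains \<open>u\<close>, and \<open>m\<close> more steps produce
          \<open>w\<close>.\<close>
        define x where "x = (subst_conf S ^^ CARD('a)\<^sup>2) \<omega>"
        have "(subst_word S ^^ q) (word_at x 0 1) \<in> conf_subwords ((subst_conf S ^^ q) x)"
          by (intro subst_word_pow_in_conf_subwords[OF ne]) simp
        moreover have "sublist u ((subst_word S ^^ q) (word_at x 0 1))"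
          using q[OF u(1,2)] by (simp add: word_at_def)
        ultimately have "u \<in> conf_subwords ((subst_conf S ^^ q) x)" by (rule conf_subwords_sublist)
        then have "(subst_word S ^^ m) u \<in> conf_subwords ((subst_conf S ^^ m) ((subst_conf S ^^ q) x))"
          by (rule subst_word_pow_in_conf_subwords[OF ne])
        then have "(subst_word S ^^ m) u \<in> conf_subwords ((subst_conf S ^^ n) \<omega>)"
          unfolding n x_def by (simp add: funpow_add)
        then show "w \<in> conf_subwords ((subst_conf S ^^ n) \<omega>)" using u(3) by (rule conf_subwords_sublist)
      qed
    qed
    also have "\<dots> \<le> 2 / (c * ?\<theta> ^ m)"
    proof -
      have "l \<le> 2 * (l div 2 + 1 + 1)" by simp
      then have "real l \<le> real (2 * (l div 2 + 1 + 1))" by (rule of_nat_mono)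
      then have "c * ?\<theta> ^ m \<le> 2 * (real (l div 2 + 1) + 1)" using l_ge by simp
      then show ?thesis using c(1) pos[of m] by (simp add: field_simps)
    qed
    also have "\<dots> = ?\<theta> ^ K * (2 / c) / ?\<theta> ^ n"
    proof -
      have "?\<theta> ^ n = ?\<theta> ^ m * ?\<theta> ^ K" using True by (simp add: m_def flip: power_add)
      then show ?thesis using \<theta> c(1) by (simp add: field_simps)
    qed
    also have "\<dots> \<le> C / ?\<theta> ^ n"
      using c(1) pos[of n] pos[of K] by (intro divide_right_mono) (auto simp: C_def distrib_left)
    finally show ?thesis .
  qed
  moreover have "0 < C" using c(1) pos[of K] by (simp add: C_def add_pos_pos)
  ultimately show ?thesis by blast
qed

section \<open>Lower bound for periodic initial configurations\<close>

lemma hausdorff_dist_lower_bound: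
  fixes S :: "'a::finite \<Rightarrow> 'a list"
  assumes ne: "\<forall>a. S a \<noteq> []" and prim: "primitive S"
    and growing: "\<exists>q. \<forall>a. 2 \<le> length ((subst_word S ^^ q) [a])"
    and inf: "infinite (subst_shift S)" and per: "periodic_conf \<omega>"
  shows "\<exists>C>0. \<forall>n. C / pf_eigenvalue S ^ n \<le> hausdorff_dist (IHS S n \<omega>) (subst_shift S)"
proof -
  let ?\<theta> = "pf_eigenvalue S"
  have \<theta>: "1 \<le> ?\<theta>" by (rule perron_frobenius(2)[OF ne prim])
  then have pos: "0 < ?\<theta> ^ n" for n by simp
  obtain C where C: "0 < C" "\<And>n w. real (length ((subst_word S ^^ n) w)) \<le> C * ?\<theta> ^ n * real (length w)"
    using length_growth(2)[OF ne prim] by blast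
  obtain u where u: "repeats u \<omega>" using per by (auto simp: periodic_conf_def repeats_def)
  then have "u \<noteq> []" by (simp add: repeats_def)
  note eq = subst_shift_eq[OF ne prim growing]
  have "1 / (C * real (length u)) / ?\<theta> ^ n \<le> hausdorff_dist (IHS S n \<omega>) (subst_shift S)" for n
  proof -
    define P where "P = length ((subst_word S ^^ n) u)"
    have "P > 0" using subst_word_pow_nonempty[OF ne \<open>u \<noteq> []\<close>] by (simp add: P_def)
    let ?A = "{w \<in> conf_subwords ((subst_conf S ^^ n) \<omega>). length w = P}"
    have A: "card ?A \<le> P" "finite ?A"
      unfolding P_def using card_words_repeats repeats_subst_conf_pow[OF ne u] by blast+
    \<comment> \<open>Counted at the period length \<open>P\<close> itself, the legal words
      outnumber those of the periodic configuration.\<close>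
    have "P < card {w \<in> legal_words S. length w = P}"
      using morse_hedlund[of "legal_words S" P] Nil_legal legal_words_sublist
        legal_word_extends[OF ne prim growing] inf unfolding eq by blast
    then have "\<not> {w \<in> legal_words S. length w = P} \<subseteq> ?A"
      using card_mono[OF A(2), of "{w \<in> legal_words S. length w = P}"] A(1) by linarith
    then obtain w where w: "w \<in> legal_words S" "length w = P" "w \<notin> conf_subwords ((subst_conf S ^^ n) \<omega>)"
      by blast
    have "1 / (C * real (length u)) / ?\<theta> ^ n = 1 / (C * ?\<theta> ^ n * real (length u))" by simp
    also have "\<dots> \<le> 1 / real P"
      using C(2)[of n u] \<open>P > 0\<close> by (intro divide_left_mono) (auto simp: P_def intro!: mult_pos_pos C(1) pos \<open>u \<noteq> []\<close>)
    also have "\<dots> \<le> hausdorff_dist (IHS S n \<omega>) (subst_shift S)"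
      unfolding IHS_eq_lang_shift eq
    \<comment> \<open>Used with radius \<open>P\<close>: the missing word has length
      \<open>P\<close>, which is at most \<open>2 * P - 1\<close> because
      \<open>P > 0\<close>.\<close>
    proof (rule hausdorff_dist_ge[OF lang_shift_conf_subwords_nonempty])
      show "w \<in> lang (lang_shift (legal_words S))"
        using w by (simp add: lang_lang_shift_legal[OF ne prim growing])
    qed (use w \<open>P > 0\<close> in auto)
    finally show ?thesis .
  qed
  moreover have "0 < 1 / (C * real (length u))" using C(1) \<open>u \<noteq> []\<close> by simp
  ultimately show ?thesis by blast
qed

section \<open>Both bounds combined, with the identity on one letter treated separately\<close>

theorem theorem2:
  fixes S :: "'a::finite \<Rightarrow> 'a list"
  assumes nonempty: "\<forall>a. S a \<noteq> []"
    and prim: "primitive S"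
  shows "(\<exists>C1>0. \<forall>\<omega>0. good_approximant S \<omega>0 \<longrightarrow>
            (\<forall>n. hausdorff_dist (IHS S n \<omega>0) (subst_shift S) \<le> C1 / pf_eigenvalue S ^ n))
       \<and> (infinite (subst_shift S) \<longrightarrow>
            (\<forall>\<omega>0. good_approximant S \<omega>0 \<and> periodic_conf \<omega>0 \<longrightarrow>
              (\<exists>C2>0. \<forall>n. C2 / pf_eigenvalue S ^ n \<le> hausdorff_dist (IHS S n \<omega>0) (subst_shift S))))"
proof -
  from primitive_growing_or_trivial[OF nonempty prim] show ?thesis
  proof (elim disjE conjE)
    assume "\<exists>q. \<forall>a. 2 \<le> length ((subst_word S ^^ q) [a])"
    then show ?thesis
      using hausdorff_dist_upper_bound[OF nonempty prim] hausdorff_dist_lower_bound[OF nonempty prim] by blast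
  next
    \<comment> \<open>Here no subshift has the language \<open>{[], [a]}\<close>, so the definite description defining
      \<open>subst_shift S\<close> denotes nothing in particular; but there is only one configuration and the
      eigenvalue is 1, hence any value of the distance is bounded by a constant.\<close>
    assume trivial: "\<forall>a b::'a. a = b" "\<forall>a. S a = [a]"
    have conf_eq: "x = y" for x y :: "'a config" using trivial(1) by (intro ext) blast
    have IHS: "IHS S n \<omega> = UNIV" for n \<omega>
      using lang_shift_conf_subwords_nonempty conf_eq unfolding IHS_eq_lang_shift
      by (metis UNIV_eq_I ex_in_conv)
    have "pf_eigenvalue S = 1"
    proof -
      obtain v :: "'a \<Rightarrow> real" where "\<And>a. 0 < v a" "\<And>a. sum_list (map v (S a)) = pf_eigenvalue S * v a"
        using perron_frobenius(1)[OF nonempty prim] by blast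
      then show ?thesis using trivial(2) by (metis list.simps(8,9) sum_list.Cons sum_list.Nil add_0_right
            mult_cancel_right1 less_irrefl)
    qed
    then have "\<exists>C1>0. \<forall>\<omega>0. good_approximant S \<omega>0 \<longrightarrow>
        (\<forall>n. hausdorff_dist (IHS S n \<omega>0) (subst_shift S) \<le> C1 / pf_eigenvalue S ^ n)"
      \<comment> \<open>The maximum with 1 keeps the constant positive.\<close>
      unfolding IHS by (intro exI[of _ "max 1 (hausdorff_dist UNIV (subst_shift S))"]) auto
    \<comment> \<open>With a single configuration the subshift cannot be infinite, so the second
      claim holds vacuously.\<close>
    moreover have "finite (subst_shift S)"
    proof (rule finite_subset)
      show "subst_shift S \<subseteq> {undefined}" using conf_eq by blast
    qed simp
    ultimately show ?thesis by blast
  qed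
qed

end
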